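(* Let $p$ be a UPLang program with distinguished integer input variable $\mathit{in}$ whose execution is uniquely determined by the value of $\mathit{in}$. Then $p$ and $\mathit{Enc}_R(p)$ are equi-safe: $p$ is safe if and only if $\mathit{Enc}_R(p)$ is safe.
   Context: UPLang is a deterministic imperative language with types $\mathit{Int}$ ($\mathbb{Z}$), $\mathit{Addr}$ ($\mathbb{N}$) and $\mathit{Obj}$ (a non-recursive algebraic data type of heap objects with a distinguished constant $\mathit{defObj}$). A heap is a finite sequence of objects, initially empty ($\mathsf{emptyHeap}$). $\mathsf{allocate}(h,o)=(h\,{+\!\!+}\,[o],|h|+1)$; $\mathsf{read}(h,a)=h[a-1]$ if $0<a\le|h|$, else $\mathit{defObj}$; $\mathsf{write}(h,a,o)=h[a-1\mapsto o]$ if $0<a\le|h|$, else $h$; $\mathbf{null}=0$. Statements: $x:=e$, $p:=\mathbf{alloc}(e)$ (stores the address returned by $\mathsf{allocate}$), $x:=\mathbf{read}(p)$ (stores $\mathsf{read}(h,s(p))$), $\mathbf{write}(p,e)$, $\mathbf{skip}$, sequencing, $\mathbf{if}$, $\mathbf{while}$ (guard $0$ is false), $\mathbf{assume}(e)$, $\mathbf{assert}(e)$, $\mathbf{assume}(P(\bar e))$, $\mathbf{assert}(P(\bar e))$ for uninterpreted predicate symbols $P$; no arithmetic on $\mathit{Addr}$ variables. Under an interpretation $\mathcal{I}$ (assigning to each predicate of arity $n$ a set of $n$-tuples of argument values), the partial big-step semantics $\delta_{\mathcal{I}}(S,s,h)$ returns an outcome in $\{\top,\bot(P,\bar v)\}$,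 a stack and a heap: a failing $\mathbf{assert}(e)$ (value $0$) yields $\bot(F,())$ with $F$ a special $0$-ary symbol, a failing $\mathbf{assert}(P(\bar e))$ (argument values $\bar v\notin\mathcal{I}(P)$) yields $\bot(P,\bar v)$, failures propagate through sequencing and loops, and a failing $\mathbf{assume}$ (expression $0$, or arguments not in $\mathcal{I}(P)$) or non-terminating loop makes the result undefined. A program $p$ is safe if there is an interpretation $\mathcal{I}$ such that for every stack $s$, $\delta_{\mathcal{I}}(p,s,\mathsf{emptyHeap})$ does not have outcome $\bot(P,\bar v)$ for any $P,\bar v$; two programs are equi-safe if one is safe iff the other is. The macro $\mathit{havoc}(x)$, using an integer variable $\mathit{seed}$, stands for: $x:=-(\mathit{seed}\%2);\ \mathit{seed}:=\mathit{seed}/2;\ \mathbf{while}\ \mathit{seed}\%2=1\ \mathbf{do}\ \{\mathit{seed}:=\mathit{seed}/2;\ x:=2\times x+(\mathit{seed}\%2);\ \mathit{seed}:=\mathit{seed}/2\};\ \mathit{seed}:=\mathit{seed}/2$. The encoding $\mathit{Enc}_R(p)$ introduces a predicate $R$ with argument types $(\mathit{Int},\mathit{Int},\mathit{Obj})$ and is obtained by: (1) redeclaring all $\mathit{Addr}$ variables of $p$ as $\mathit{Int}$ variables; (2) introducing fresh variables $\mathit{cnt}_{alloc},\mathit{cnt}:\mathit{Int}$, $\mathit{last}:\mathit{Obj}$, $\mathit{last}_{Addr}:\mathit{Int}$ (left uninitialised, so its value comes from the initial stack) and prepending $\mathit{cnt}_{alloc}:=0;\ \mathit{cnt}:=0;\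 \mathit{last}:=\mathit{defObj}$; (3) replacing each $q:=\mathbf{alloc}(e)$ by $\mathit{cnt}_{alloc}:=\mathit{cnt}_{alloc}+1;\ q:=\mathit{cnt}_{alloc};\ \mathbf{if}\ \mathit{last}_{Addr}=q\ \{\mathit{last}:=e\}$; each $x:=\mathbf{read}(q)$ by $\mathit{cnt}:=\mathit{cnt}+1;\ \mathbf{if}\ \mathit{last}_{Addr}=q\ \mathbf{then}\ \{\mathbf{assert}(R(\mathit{in},\mathit{cnt},\mathit{last}));\ x:=\mathit{last}\}\ \mathbf{else}\ \{\mathit{havoc}(x);\ \mathbf{assume}(R(\mathit{in},\mathit{cnt},x))\}$; and each $\mathbf{write}(q,e)$ by $\mathbf{if}\ (\mathit{last}_{Addr}=q\wedge 0<q\le\mathit{cnt}_{alloc})\ \{\mathit{last}:=e\}$, where $\mathbf{if}\ e\ \{S\}$ abbreviates $\mathbf{if}\ e\ \mathbf{then}\ \{S\}\ \mathbf{else}\ \{\mathbf{skip}\}$.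
   Formalization: Proved for programs that never assign to in and where q does not occur in e in any q := alloc(e); "execution" means the whole run, including blocked or diverging ones; Addr fields and predicate arguments also become Int, and havoc is extended to Obj. *)

theory Defs
  imports Main
begin

section \<open>UPLang: types, values, expressions\<close>

type_synonym vname = string
type_synonym pname = string

datatype ty = TInt | TAddr | TObj

text \<open>
  \<open>Addr\<close> (the naturals) is regarded as the subset of non-negative elements of \<open>Int\<close>, so an address
  is an \<open>IntV\<close> and only the declared type of a variable (or field) restricts it to be
  non-negative. An object is a constructor index together with the values of its fields; as the
  data type is not recursive, all fields are of type \<open>Int\<close> or \<open>Addr\<close>.
\<close>

datatype obj = Obj nat "int list"

datatype val = IntV int | ObjV obj

text \<open>A data type is given by the list of its constructors, each being the list of its field types.\<close>

type_synonym adt = "ty list list"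

definition nonrecursive :: "adt \<Rightarrow> bool" where
  "nonrecursive C \<longleftrightarrow> (\<forall>ts \<in> set C. TObj \<notin> set ts)"

fun has_type :: "adt \<Rightarrow> val \<Rightarrow> ty \<Rightarrow> bool" where
  "has_type C (IntV n) TInt \<longleftrightarrow> True"
| "has_type C (IntV n) TAddr \<longleftrightarrow> 0 \<le> n"
| "has_type C (ObjV (Obj k fs)) TObj \<longleftrightarrow>
     k < length C \<and> list_all2 (\<lambda>f t. t = TAddr \<longrightarrow> 0 \<le> f) fs (C ! k)"
| "has_type C _ _ \<longleftrightarrow> False"

datatype binop = Plus | Minus | Times | Divide | Modulo | Less | LessEq | Conj | Disj

text \<open>
  The constant null is \<open>Num 0\<close>. \<open>Sel k i e\<close> selects field \<open>i\<close> of an object built by constructor \<open>k\<close>,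
  \<open>Is k e\<close> tests for constructor \<open>k\<close>.
\<close>

datatype exp =
    Var vname
  | Num int
  | DefObj
  | UMinus exp
  | Not exp
  | Bin binop exp exp
  | Eq exp exp
  | Ctor nat "exp list"
  | Sel nat nat exp
  | Is nat exp

type_synonym stack = "vname \<Rightarrow> val"

text \<open>The values on arguments of the wrong kind are irrelevant for well-typed programs.\<close>

fun int_of :: "val \<Rightarrow> int" where
  "int_of (IntV n) = n"
| "int_of (ObjV _) = 0"

fun obj_of :: "val \<Rightarrow> obj" where
  "obj_of (ObjV x) = x"
| "obj_of (IntV _) = Obj 0 []"

definition truth :: "bool \<Rightarrow> int" where
  "truth b = (if b then 1 else 0)"

fun binop_val :: "binop \<Rightarrow> int \<Rightarrow> int \<Rightarrow> int" where
  "binop_val Plus m n = m + n"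
| "binop_val Minus m n = m - n"
| "binop_val Times m n = m * n"
| "binop_val Divide m n = m div n"
| "binop_val Modulo m n = m mod n"
| "binop_val Less m n = truth (m < n)"
| "binop_val LessEq m n = truth (m \<le> n)"
| "binop_val Conj m n = truth (m \<noteq> 0 \<and> n \<noteq> 0)"
| "binop_val Disj m n = truth (m \<noteq> 0 \<or> n \<noteq> 0)"

text \<open>A selector applied to an object of another constructor yields \<open>0\<close>, which is both an \<open>Int\<close> and an \<open>Addr\<close>.\<close>

fun select :: "nat \<Rightarrow> nat \<Rightarrow> obj \<Rightarrow> int" where
  "select k i (Obj k' fs) = (if k' = k \<and> i < length fs then fs ! i else 0)"

fun is_ctor :: "nat \<Rightarrow> obj \<Rightarrow> bool" where
  "is_ctor k (Obj k' fs) \<longleftrightarrow> k' = k"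

text \<open>In the following, \<open>D\<close> is always the object denoted by \<open>DefObj\<close>.\<close>

fun eval :: "obj \<Rightarrow> exp \<Rightarrow> stack \<Rightarrow> val" where
  "eval D (Var x) s = s x"
| "eval D (Num n) s = IntV n"
| "eval D DefObj s = ObjV D"
| "eval D (UMinus e) s = IntV (- int_of (eval D e s))"
| "eval D (Not e) s = IntV (truth (int_of (eval D e s) = 0))"
| "eval D (Bin f e1 e2) s = IntV (binop_val f (int_of (eval D e1 s)) (int_of (eval D e2 s)))"
| "eval D (Eq e1 e2) s = IntV (truth (eval D e1 s = eval D e2 s))"
| "eval D (Ctor k es) s = ObjV (Obj k (map (\<lambda>e. int_of (eval D e s)) es))"
| "eval D (Sel k i e) s = IntV (select k i (obj_of (eval D e s)))"
| "eval D (Is k e) s = IntV (truth (is_ctor k (obj_of (eval D e s))))"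

text \<open>
  There is no arithmetic on addresses: expressions of type \<open>Addr\<close> are null, variables and
  field selections, and the only operation that inspects them is equality.
\<close>

inductive wt_exp :: "adt \<Rightarrow> (vname \<Rightarrow> ty) \<Rightarrow> exp \<Rightarrow> ty \<Rightarrow> bool" for C G where
  "wt_exp C G (Var x) (G x)"
| "wt_exp C G (Num n) TInt"
| "wt_exp C G (Num 0) TAddr"
| "wt_exp C G DefObj TObj"
| "wt_exp C G e TInt \<Longrightarrow> wt_exp C G (UMinus e) TInt"
| "wt_exp C G e TInt \<Longrightarrow> wt_exp C G (Not e) TInt"
| "wt_exp C G e1 TInt \<Longrightarrow> wt_exp C G e2 TInt \<Longrightarrow> wt_exp C G (Bin f e1 e2) TInt"
| "wt_exp C G e1 t \<Longrightarrow> wt_exp C G e2 t \<Longrightarrow> wt_exp C G (Eq e1 e2) TInt"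
| "k < length C \<Longrightarrow> list_all2 (wt_exp C G) es (C ! k) \<Longrightarrow> wt_exp C G (Ctor k es) TObj"
| "k < length C \<Longrightarrow> i < length (C ! k) \<Longrightarrow> wt_exp C G e TObj \<Longrightarrow> wt_exp C G (Sel k i e) (C ! k ! i)"
| "k < length C \<Longrightarrow> wt_exp C G e TObj \<Longrightarrow> wt_exp C G (Is k e) TInt"

fun vars_exp :: "exp \<Rightarrow> vname set" where
  "vars_exp (Var x) = {x}"
| "vars_exp (Num n) = {}"
| "vars_exp DefObj = {}"
| "vars_exp (UMinus e) = vars_exp e"
| "vars_exp (Not e) = vars_exp e"
| "vars_exp (Bin f e1 e2) = vars_exp e1 \<union> vars_exp e2"
| "vars_exp (Eq e1 e2) = vars_exp e1 \<union> vars_exp e2"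
| "vars_exp (Ctor k es) = (\<Union>e \<in> set es. vars_exp e)"
| "vars_exp (Sel k i e) = vars_exp e"
| "vars_exp (Is k e) = vars_exp e"

section \<open>Heaps\<close>

type_synonym heap = "obj list"

definition emptyHeap :: heap where
  "emptyHeap = []"

definition allocate :: "heap \<Rightarrow> obj \<Rightarrow> heap \<times> int" where
  "allocate h x = (h @ [x], int (length h) + 1)"

definition heap_read :: "obj \<Rightarrow> heap \<Rightarrow> int \<Rightarrow> obj" where
  "heap_read D h a = (if 0 < a \<and> a \<le> int (length h) then h ! nat (a - 1) else D)"

definition heap_write :: "heap \<Rightarrow> int \<Rightarrow> obj \<Rightarrow> heap" where
  "heap_write h a x = (if 0 < a \<and> a \<le> int (length h) then h[nat (a - 1) := x] else h)"

section \<open>Statements and their semantics\<close>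

datatype stmt =
    Assign vname exp
  | Alloc vname exp
  | Read vname vname
  | Write vname exp
  | Skip
  | Seq stmt stmt  (infixr \<open>;;\<close> 60)
  | If exp stmt stmt
  | While exp stmt
  | Assume exp
  | Assert exp
  | AssumeP pname "exp list"
  | AssertP pname "exp list"

inductive wt_stmt :: "adt \<Rightarrow> (pname \<Rightarrow> ty list) \<Rightarrow> (vname \<Rightarrow> ty) \<Rightarrow> stmt \<Rightarrow> bool" for C A G where
  "wt_exp C G e (G x) \<Longrightarrow> wt_stmt C A G (Assign x e)"
| "G q = TAddr \<Longrightarrow> wt_exp C G e TObj \<Longrightarrow> wt_stmt C A G (Alloc q e)"
| "G x = TObj \<Longrightarrow> G q = TAddr \<Longrightarrow> wt_stmt C A G (Read x q)"
| "G q = TAddr \<Longrightarrow> wt_exp C G e TObj \<Longrightarrow> wt_stmt C A G (Write q e)"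
| "wt_stmt C A G Skip"
| "wt_stmt C A G S1 \<Longrightarrow> wt_stmt C A G S2 \<Longrightarrow> wt_stmt C A G (S1 ;; S2)"
| "wt_exp C G e TInt \<Longrightarrow> wt_stmt C A G S1 \<Longrightarrow> wt_stmt C A G S2 \<Longrightarrow> wt_stmt C A G (If e S1 S2)"
| "wt_exp C G e TInt \<Longrightarrow> wt_stmt C A G S \<Longrightarrow> wt_stmt C A G (While e S)"
| "wt_exp C G e TInt \<Longrightarrow> wt_stmt C A G (Assume e)"
| "wt_exp C G e TInt \<Longrightarrow> wt_stmt C A G (Assert e)"
| "list_all2 (wt_exp C G) es (A P) \<Longrightarrow> wt_stmt C A G (AssumeP P es)"
| "list_all2 (wt_exp C G) es (A P) \<Longrightarrow> wt_stmt C A G (AssertP P es)"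

fun vars_stmt :: "stmt \<Rightarrow> vname set" where
  "vars_stmt (Assign x e) = insert x (vars_exp e)"
| "vars_stmt (Alloc q e) = insert q (vars_exp e)"
| "vars_stmt (Read x q) = {x, q}"
| "vars_stmt (Write q e) = insert q (vars_exp e)"
| "vars_stmt Skip = {}"
| "vars_stmt (S1 ;; S2) = vars_stmt S1 \<union> vars_stmt S2"
| "vars_stmt (If e S1 S2) = vars_exp e \<union> vars_stmt S1 \<union> vars_stmt S2"
| "vars_stmt (While e S) = vars_exp e \<union> vars_stmt S"
| "vars_stmt (Assume e) = vars_exp e"
| "vars_stmt (Assert e) = vars_exp e"
| "vars_stmt (AssumeP P es) = (\<Union>e \<in> set es. vars_exp e)"
| "vars_stmt (AssertP P es) = (\<Union>e \<in> set es. vars_exp e)"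

fun assigned :: "stmt \<Rightarrow> vname set" where
  "assigned (Assign x e) = {x}"
| "assigned (Alloc q e) = {q}"
| "assigned (Read x q) = {x}"
| "assigned (S1 ;; S2) = assigned S1 \<union> assigned S2"
| "assigned (If e S1 S2) = assigned S1 \<union> assigned S2"
| "assigned (While e S) = assigned S"
| "assigned _ = {}"

fun preds_stmt :: "stmt \<Rightarrow> pname set" where
  "preds_stmt (S1 ;; S2) = preds_stmt S1 \<union> preds_stmt S2"
| "preds_stmt (If e S1 S2) = preds_stmt S1 \<union> preds_stmt S2"
| "preds_stmt (While e S) = preds_stmt S"
| "preds_stmt (AssumeP P es) = {P}"
| "preds_stmt (AssertP P es) = {P}"
| "preds_stmt _ = {}"

type_synonym interp = "pname \<Rightarrow> val list set"

text \<open>\<open>FSym\<close> is the special 0-ary symbol reported by a failing assertion of an expression.\<close>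

datatype sym = FSym | Pred pname

datatype outcome = Top | Bot sym "val list"

text \<open>
  An execution is recorded as the sequence of its elementary actions, with the values
  they involve.
\<close>

datatype event =
    EvAssign vname val
  | EvAlloc vname int obj
  | EvRead vname int obj
  | EvWrite vname int obj
  | EvGuard val
  | EvCheck val
  | EvPred pname "val list"

text \<open>
  \<open>Fin\<close> is a proper result. \<open>Cut\<close> stands for an execution that has not produced a result: it was
  interrupted at an arbitrary point (rule \<open>cut\<close>), or has got stuck at a failing assume.
\<close>

datatype result = Fin outcome stack heap | Cut

text \<open>
  \<open>exec D I S s h tr r\<close> is the big-step semantics, instrumented with the sequence \<open>tr\<close> of actions. By
  virtue of \<open>Cut\<close> it also describes the finite initial segments of executions
  that do not terminate or that end in a failing assume.
\<close>

inductive exec ::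
  "obj \<Rightarrow> interp \<Rightarrow> stmt \<Rightarrow> stack \<Rightarrow> heap \<Rightarrow> event list \<Rightarrow> result \<Rightarrow> bool"
  for D I where
  cut: "exec D I S s h [] Cut"
| assign: "v = eval D e s \<Longrightarrow>
    exec D I (Assign x e) s h [EvAssign x v] (Fin Top (s(x := v)) h)"
| alloc: "v = obj_of (eval D e s) \<Longrightarrow> allocate h v = (h', a) \<Longrightarrow>
    exec D I (Alloc q e) s h [EvAlloc q a v] (Fin Top (s(q := IntV a)) h')"
| load: "a = int_of (s q) \<Longrightarrow> v = heap_read D h a \<Longrightarrow>
    exec D I (Read x q) s h [EvRead x a v] (Fin Top (s(x := ObjV v)) h)"
| store: "a = int_of (s q) \<Longrightarrow> v = obj_of (eval D e s) \<Longrightarrow>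
    exec D I (Write q e) s h [EvWrite q a v] (Fin Top s (heap_write h a v))"
| skip: "exec D I Skip s h [] (Fin Top s h)"
| seq: "exec D I S1 s h tr1 (Fin Top s1 h1) \<Longrightarrow> exec D I S2 s1 h1 tr2 r \<Longrightarrow>
    exec D I (S1 ;; S2) s h (tr1 @ tr2) r"
| seq_abort: "exec D I S1 s h tr r \<Longrightarrow> (\<forall>s1 h1. r \<noteq> Fin Top s1 h1) \<Longrightarrow>
    exec D I (S1 ;; S2) s h tr r"
| if_true: "v = eval D e s \<Longrightarrow> v \<noteq> IntV 0 \<Longrightarrow> exec D I S1 s h tr r \<Longrightarrow>
    exec D I (If e S1 S2) s h (EvGuard v # tr) r"
| if_false: "v = eval D e s \<Longrightarrow> v = IntV 0 \<Longrightarrow> exec D I S2 s h tr r \<Longrightarrow>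
    exec D I (If e S1 S2) s h (EvGuard v # tr) r"
| while: "exec D I (If e (S ;; While e S) Skip) s h tr r \<Longrightarrow>
    exec D I (While e S) s h tr r"
| assume_ok: "v = eval D e s \<Longrightarrow> v \<noteq> IntV 0 \<Longrightarrow>
    exec D I (Assume e) s h [EvCheck v] (Fin Top s h)"
| assume_fail: "v = eval D e s \<Longrightarrow> v = IntV 0 \<Longrightarrow>
    exec D I (Assume e) s h [EvCheck v] Cut"
| assert_ok: "v = eval D e s \<Longrightarrow> v \<noteq> IntV 0 \<Longrightarrow>
    exec D I (Assert e) s h [EvCheck v] (Fin Top s h)"
| assert_fail: "v = eval D e s \<Longrightarrow> v = IntV 0 \<Longrightarrow>
    exec D I (Assert e) s h [EvCheck v] (Fin (Bot FSym []) s h)"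
| assumeP_ok: "vs = map (\<lambda>e. eval D e s) es \<Longrightarrow> vs \<in> I P \<Longrightarrow>
    exec D I (AssumeP P es) s h [EvPred P vs] (Fin Top s h)"
| assumeP_fail: "vs = map (\<lambda>e. eval D e s) es \<Longrightarrow> vs \<notin> I P \<Longrightarrow>
    exec D I (AssumeP P es) s h [EvPred P vs] Cut"
| assertP_ok: "vs = map (\<lambda>e. eval D e s) es \<Longrightarrow> vs \<in> I P \<Longrightarrow>
    exec D I (AssertP P es) s h [EvPred P vs] (Fin Top s h)"
| assertP_fail: "vs = map (\<lambda>e. eval D e s) es \<Longrightarrow> vs \<notin> I P \<Longrightarrow>
    exec D I (AssertP P es) s h [EvPred P vs] (Fin (Bot (Pred P) vs) s h)"


lemma exec_deterministic:
  assumes "exec D I S s h tr r" and "exec D I S s h tr' r'" and "r \<noteq> Cut" and "r' \<noteq> Cut"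
  shows "r = r' \<and> tr = tr'"
  using assms
proof (induction arbitrary: tr' r' rule: exec.induct)
  case (seq S1 s h tr1 s1 h1 S2 tr2 r)
  from seq.prems(1) show ?case
  proof cases
    case cut
    with seq.prems show ?thesis by simp
  next
    case *: (seq tr1' s1' h1' tr2')
    from seq.IH(1)[OF *(2)] have "s1' = s1" "h1' = h1" "tr1' = tr1" by simp_all
    with * seq.IH(2)[of tr2' r'] seq.prems show ?thesis by simp
  next
    case seq_abort
    with seq.IH(1)[OF seq_abort(1)] seq.prems show ?thesis by auto
  qed
next
  case (seq_abort S1 s h tr r S2)
  from seq_abort.prems(1) show ?case
  proof cases
    case cut
    with seq_abort.prems show ?thesis by simp
  next
    case (seq tr1' s1' h1' tr2')
    with seq_abort.IH[OF seq(2)] seq_abort.prems seq_abort.hyps show ?thesis by auto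
  next
    case a: seq_abort
    from seq_abort.IH[OF a(1)] seq_abort.prems show ?thesis by simp
  qed
next
  case (if_true v e s S1 h tr r S2)
  from if_true.prems(1) show ?case
  proof cases
    case cut
    with if_true.prems show ?thesis by simp
  next
    case a: (if_true v' tr')
    with if_true.IH[of tr' r'] if_true.prems if_true.hyps show ?thesis by simp
  next
    case (if_false v' tr')
    with if_true.hyps show ?thesis by simp
  qed
next
  case (if_false v e s S2 h tr r S1)
  from if_false.prems(1) show ?case
  proof cases
    case cut
    with if_false.prems show ?thesis by simp
  next
    case a: (if_false v' tr')
    with if_false.IH[of tr' r'] if_false.prems if_false.hyps show ?thesis by simp
  next
    case (if_true v' tr')
    with if_false.hyps show ?thesis by simp
  qed
next
  case (while e S s h tr r)
  from while.prems(1) show ?case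
  proof cases
    case cut
    with while.prems show ?thesis by simp
  next
    case a: while
    from while.IH[OF a] while.prems show ?thesis by simp
  qed
next
  case cut
  then show ?case by simp
next
  case assign
  from assign.prems(1) show ?case
    by cases (use assign in simp_all)
next
  case alloc
  from alloc.prems(1) show ?case
    by cases (use alloc in simp_all)
next
  case load
  from load.prems(1) show ?case
    by cases (use load in simp_all)
next
  case store
  from store.prems(1) show ?case
    by cases (use store in simp_all)
next
  case skip
  from skip.prems(1) show ?case
    by cases (use skip in simp_all)
next
  case assume_ok
  from assume_ok.prems(1) show ?case
    by cases (use assume_ok in simp_all)
next
  case assume_fail
  from assume_fail.prems(1) show ?case
    by cases (use assume_fail in simp_all)
next
  case assert_ok
  from assert_ok.prems(1) show ?case
    by cases (use assert_ok in simp_all)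
next
  case assert_fail
  from assert_fail.prems(1) show ?case
    by cases (use assert_fail in simp_all)
next
  case assumeP_ok
  from assumeP_ok.prems(1) show ?case
    by cases (use assumeP_ok in simp_all)
next
  case assumeP_fail
  from assumeP_fail.prems(1) show ?case
    by cases (use assumeP_fail in simp_all)
next
  case assertP_ok
  from assertP_ok.prems(1) show ?case
    by cases (use assertP_ok in simp_all)
next
  case assertP_fail
  from assertP_fail.prems(1) show ?case
    by cases (use assertP_fail in simp_all)
qed

text \<open>The partial semantic function; \<open>None\<close> means undefined.\<close>

definition delta :: "obj \<Rightarrow> interp \<Rightarrow> stmt \<Rightarrow> stack \<Rightarrow> heap \<Rightarrow> (outcome \<times> stack \<times> heap) option" where
  "delta D I S s h =
     (if \<exists>tr b s' h'. exec D I S s h tr (Fin b s' h')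
      then Some (THE (b, s', h'). \<exists>tr. exec D I S s h tr (Fin b s' h'))
      else None)"

lemma delta_eq_Some_iff:
  "delta D I S s h = Some (b, s', h') \<longleftrightarrow> (\<exists>tr. exec D I S s h tr (Fin b s' h'))"
proof -
  have unique: "b1 = b2 \<and> s1 = s2 \<and> h1 = h2"
    if "exec D I S s h tr1 (Fin b1 s1 h1)" "exec D I S s h tr2 (Fin b2 s2 h2)"
    for tr1 b1 s1 h1 tr2 b2 s2 h2
    using exec_deterministic[OF that] by simp
  have the: "delta D I S s h = Some (b1, s1, h1)" if e: "exec D I S s h tr (Fin b1 s1 h1)" for tr b1 s1 h1
  proof -
    have "(THE (b, s', h'). \<exists>tr. exec D I S s h tr (Fin b s' h')) = (b1, s1, h1)"
    proof (rule the_equality)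
      show "case (b1, s1, h1) of (b, s', h') \<Rightarrow> \<exists>tr. exec D I S s h tr (Fin b s' h')"
        using e by (simp only: prod.case) (rule exI)
    next
      fix y
      assume y: "case y of (b, s', h') \<Rightarrow> \<exists>tr. exec D I S s h tr (Fin b s' h')"
      obtain b2 s2 h2 where y2: "y = (b2, s2, h2)" by (cases y)
      with y obtain tr2 where "exec D I S s h tr2 (Fin b2 s2 h2)"
        by (simp only: prod.case) (erule exE)
      from unique[OF this e] y2 show "y = (b1, s1, h1)" by simp
    qed
    moreover have "\<exists>tr b s' h'. exec D I S s h tr (Fin b s' h')" using e by blast
    ultimately show ?thesis unfolding delta_def by (simp only: if_True)
  qed
  show ?thesis
  proof
    assume d: "delta D I S s h = Some (b, s', h')"
    then have "\<exists>tr b s' h'. exec D I S s h tr (Fin b s' h')"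
      unfolding delta_def by (meson option.distinct(1))
    then obtain tr b1 s1 h1 where e: "exec D I S s h tr (Fin b1 s1 h1)" by blast
    with the[OF e] d show "\<exists>tr. exec D I S s h tr (Fin b s' h')" by auto
  next
    assume "\<exists>tr. exec D I S s h tr (Fin b s' h')"
    then show "delta D I S s h = Some (b, s', h')" using the by blast
  qed
qed

definition executions :: "obj \<Rightarrow> interp \<Rightarrow> stmt \<Rightarrow> stack \<Rightarrow> heap \<Rightarrow> event list set" where
  "executions D I S s h = {tr. \<exists>r. exec D I S s h tr r}"

section \<open>Programs and safety\<close>

text \<open>Every name carries a declaration; those that do not occur in the body are irrelevant.\<close>

record program =
  ctors :: adt
  def_obj :: obj
  preds :: "pname \<Rightarrow> ty list"
  vars :: "vname \<Rightarrow> ty"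
  body :: stmt

definition wf_program :: "program \<Rightarrow> bool" where
  "wf_program p \<longleftrightarrow>
     nonrecursive (ctors p) \<and>
     has_type (ctors p) (ObjV (def_obj p)) TObj \<and>
     wt_stmt (ctors p) (preds p) (vars p) (body p)"

definition interps :: "program \<Rightarrow> interp set" where
  "interps p = {I. \<forall>P. \<forall>vs \<in> I P. list_all2 (has_type (ctors p)) vs (preds p P)}"

definition stacks :: "program \<Rightarrow> stack set" where
  "stacks p = {s. \<forall>x. has_type (ctors p) (s x) (vars p x)}"

definition safe :: "program \<Rightarrow> bool" where
  "safe p \<longleftrightarrow> (\<exists>I \<in> interps p. \<forall>s \<in> stacks p.
     \<not> (\<exists>P vs s' h'. delta (def_obj p) I (body p) s emptyHeap = Some (Bot P vs, s', h')))"

definition equi_safe :: "program \<Rightarrow> program \<Rightarrow> bool" where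
  "equi_safe p p' \<longleftrightarrow> (safe p \<longleftrightarrow> safe p')"

text \<open>
  The execution is uniquely determined by the value of \<open>x\<close>. This concerns the entire execution, also
  a non-terminating or blocked one, and not merely its final result: the sets of
  initial segments have to coincide.
\<close>

definition determined_by :: "vname \<Rightarrow> program \<Rightarrow> bool" where
  "determined_by x p \<longleftrightarrow> (\<forall>I \<in> interps p. \<forall>s \<in> stacks p. \<forall>s' \<in> stacks p. s x = s' x \<longrightarrow>
     executions (def_obj p) I (body p) s emptyHeap = executions (def_obj p) I (body p) s' emptyHeap)"

text \<open>The input variable is read-only.\<close>

definition input_var :: "vname \<Rightarrow> program \<Rightarrow> bool" where
  "input_var x p \<longleftrightarrow> vars p x = TInt \<and> x \<notin> assigned (body p)"

section \<open>The encoding\<close>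

text \<open>
  \<open>tag\<close> and \<open>fld i\<close> are auxiliary variables for the havoc of an object.
\<close>

record aux_vars =
  cnt_alloc :: vname
  cnt :: vname
  last_obj :: vname
  last_addr :: vname
  seed :: vname
  tag :: vname
  fld :: "nat \<Rightarrow> vname"

definition scalar_vars :: "aux_vars \<Rightarrow> vname list" where
  "scalar_vars N = [cnt_alloc N, cnt N, last_obj N, last_addr N, seed N, tag N]"

definition fresh_vars :: "aux_vars \<Rightarrow> vname set \<Rightarrow> bool" where
  "fresh_vars N X \<longleftrightarrow>
     distinct (scalar_vars N) \<and> inj (fld N) \<and> set (scalar_vars N) \<inter> range (fld N) = {} \<and>
     (set (scalar_vars N) \<union> range (fld N)) \<inter> X = {}"

abbreviation IfThen :: "exp \<Rightarrow> stmt \<Rightarrow> stmt" where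
  "IfThen e S \<equiv> If e S Skip"

definition havoc_int :: "aux_vars \<Rightarrow> vname \<Rightarrow> stmt" where
  "havoc_int N x =
     (let sd = Var (seed N);
          bit = Bin Modulo sd (Num 2);
          shift = Assign (seed N) (Bin Divide sd (Num 2))
      in Assign x (UMinus bit) ;;
         shift ;;
         While (Eq bit (Num 1))
           (shift ;;
            Assign x (Bin Plus (Bin Times (Num 2) (Var x)) bit) ;;
            shift) ;;
         shift)"

text \<open>
  Havoc of an object: havoc the index of the constructor, then all of its arguments. (The
  redeclaration of addresses as integers has made all of these integers. For an index
  that does not exist, \<open>x\<close> keeps its value.)
\<close>

fun havoc_list :: "aux_vars \<Rightarrow> vname list \<Rightarrow> stmt" where
  "havoc_list N [] = Skip"
| "havoc_list N (x # xs) = havoc_int N x ;; havoc_list N xs"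

fun havoc_ctors :: "aux_vars \<Rightarrow> vname \<Rightarrow> nat \<Rightarrow> adt \<Rightarrow> stmt" where
  "havoc_ctors N x k [] = Skip"
| "havoc_ctors N x k (ts # C) =
     (let fs = map (fld N) [0..<length ts]
      in If (Eq (Var (tag N)) (Num (int k)))
           (havoc_list N fs ;; Assign x (Ctor k (map Var fs)))
           (havoc_ctors N x (Suc k) C))"

definition havoc_obj :: "aux_vars \<Rightarrow> adt \<Rightarrow> vname \<Rightarrow> stmt" where
  "havoc_obj N C x = havoc_int N (tag N) ;; havoc_ctors N x 0 C"

fun enc_stmt :: "pname \<Rightarrow> vname \<Rightarrow> aux_vars \<Rightarrow> adt \<Rightarrow> stmt \<Rightarrow> stmt" where
  "enc_stmt R inp N C (Alloc q e) =
     Assign (cnt_alloc N) (Bin Plus (Var (cnt_alloc N)) (Num 1)) ;;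
     Assign q (Var (cnt_alloc N)) ;;
     IfThen (Eq (Var (last_addr N)) (Var q)) (Assign (last_obj N) e)"
| "enc_stmt R inp N C (Read x q) =
     Assign (cnt N) (Bin Plus (Var (cnt N)) (Num 1)) ;;
     If (Eq (Var (last_addr N)) (Var q))
       (AssertP R [Var inp, Var (cnt N), Var (last_obj N)] ;;
        Assign x (Var (last_obj N)))
       (havoc_obj N C x ;;
        AssumeP R [Var inp, Var (cnt N), Var x])"
| "enc_stmt R inp N C (Write q e) =
     IfThen (Bin Conj (Eq (Var (last_addr N)) (Var q))
              (Bin Conj (Bin Less (Num 0) (Var q)) (Bin LessEq (Var q) (Var (cnt_alloc N)))))
       (Assign (last_obj N) e)"
| "enc_stmt R inp N C (S1 ;; S2) = enc_stmt R inp N C S1 ;; enc_stmt R inp N C S2"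
| "enc_stmt R inp N C (If e S1 S2) = If e (enc_stmt R inp N C S1) (enc_stmt R inp N C S2)"
| "enc_stmt R inp N C (While e S) = While e (enc_stmt R inp N C S)"
| "enc_stmt R inp N C S = S"

text \<open>
  Redeclaration of addresses as integers. To keep the encoded program well-typed, it
  has to extend to the fields of objects and the arguments of predicates.
\<close>

fun redeclare :: "ty \<Rightarrow> ty" where
  "redeclare TAddr = TInt"
| "redeclare t = t"

definition Enc :: "pname \<Rightarrow> vname \<Rightarrow> aux_vars \<Rightarrow> program \<Rightarrow> program" where
  "Enc R inp N p =
     \<lparr> ctors = map (map redeclare) (ctors p),
       def_obj = def_obj p,
       preds = (map redeclare \<circ> preds p)(R := [TInt, TInt, TObj]),
       vars = (\<lambda>x. if x = last_obj N then TObj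
                   else if x \<in> set (scalar_vars N) \<union> range (fld N) then TInt
                   else redeclare (vars p x)),
       body =
         Assign (cnt_alloc N) (Num 0) ;;
         Assign (cnt N) (Num 0) ;;
         Assign (last_obj N) DefObj ;;
         enc_stmt R inp N (ctors p) (body p) \<rparr>"

text \<open>
  The encoding of \<open>q := alloc(e)\<close> assigns to \<open>q\<close> before it evaluates \<open>e\<close>, and so presupposes that
  \<open>q\<close> does not occur in \<open>e\<close>.
\<close>

fun alloc_ok :: "stmt \<Rightarrow> bool" where
  "alloc_ok (Alloc q e) \<longleftrightarrow> q \<notin> vars_exp e"
| "alloc_ok (S1 ;; S2) \<longleftrightarrow> alloc_ok S1 \<and> alloc_ok S2"
| "alloc_ok (If e S1 S2) \<longleftrightarrow> alloc_ok S1 \<and> alloc_ok S2"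
| "alloc_ok (While e S) \<longleftrightarrow> alloc_ok S"
| "alloc_ok _ \<longleftrightarrow> True"

end

(*
  Fix an address L, the initial value of the uninitialised variable last_addr. Along an execution of
  the program, the encoding keeps the object stored at L in a variable, and exchanges all other objects
  through R, which ought to relate the n-th read under input i to the object that is read.

  If the program is safe, let R consist of exactly the objects that are read by it. As the input
  determines the execution, there is one object for each i and n, so that the asserts of R succeed and
  the assumes only let the object pass that the program itself would read. Hence a failure of the
  encoding is a failure of the program. The encoding may however start with negative addresses,
  and the program may not. Renaming addresses maps such an execution to one of the program as long as
  no renamed address reaches a predicate; and by determinacy none does, as two renamings that
  agree only on the addresses they fix would lead to different events.

  If the encoding is safe under I', the program is safe under the well-typed part of I': otherwise
  take a failing execution, and for L the address of its first read that is not recorded in I' R, if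
  any. Choosing the seed such that each havoc guesses the object read, the encoding follows the program and fails
  either at the assertion of R at this read or where the program does.
*)

theory Submission
  imports Defs "HOL-Library.Sublist"
begin

text \<open>The encoding must not fail at an assertion of \<open>R\<close> even where the program
  later blocks or diverges. So \<open>R\<close> is collected from all finite initial segments of
  executions, not from results. As the semantics is deterministic, the segments from one stack form
  a chain; together with determinacy in the input, this makes the n-th read a function of the input.
  Renaming cannot be a plain simulation, since an interpretation may contain a tuple and not its
  renaming. It is therefore pursued only up to the first event that it changes, and that is where
  the two renamings are compared. The two simulations have opposite shapes. From the encoding to the
  program the seed is given, the induction is on the statement, and the exactness of
  \<open>R\<close> discards all wrong guesses. From the program to the encoding the execution is
  given, the induction is on its derivation, and the seed is computed from the end of the run back
  to its beginning. The failing read has to be the first unrecorded one, so that before it all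
  guesses and assertions pass, at whatever address they occur.\<close>

inductive_cases exec_AssignE: "exec D I (Assign x e) s h tr r"
inductive_cases exec_AllocE: "exec D I (Alloc q e) s h tr r"
inductive_cases exec_ReadE: "exec D I (Read x q) s h tr r"
inductive_cases exec_WriteE: "exec D I (Write q e) s h tr r"
inductive_cases exec_SkipE: "exec D I Skip s h tr r"
inductive_cases exec_SeqE: "exec D I (S1 ;; S2) s h tr r"
inductive_cases exec_IfE: "exec D I (If e S1 S2) s h tr r"
inductive_cases exec_WhileE: "exec D I (While e S) s h tr r"
inductive_cases exec_AssumeE: "exec D I (Assume e) s h tr r"
inductive_cases exec_AssertE: "exec D I (Assert e) s h tr r"
inductive_cases exec_AssumePE: "exec D I (AssumeP P es) s h tr r"
inductive_cases exec_AssertPE: "exec D I (AssertP P es) s h tr r"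

lemmas exec_primE = exec_AssignE exec_AllocE exec_ReadE exec_WriteE exec_SkipE
  exec_AssumeE exec_AssertE exec_AssumePE exec_AssertPE

lemma exec_Seq_cases [consumes 1, case_names cut ok fail]:
  assumes "exec D I (S1 ;; S2) s h tr r"
  obtains "tr = []" "r = Cut"
  | tr1 s1 h1 tr2 where "tr = tr1 @ tr2" "exec D I S1 s h tr1 (Fin Top s1 h1)"
      "exec D I S2 s1 h1 tr2 r"
  | "exec D I S1 s h tr r" "\<forall>s1 h1. r \<noteq> Fin Top s1 h1"
  using assms by (rule exec_SeqE) blast+

lemma exec_If_cases [consumes 1, case_names cut true false]:
  assumes "exec D I (If e S1 S2) s h tr r"
  obtains "tr = []" "r = Cut"
  | tr1 where "tr = EvGuard (eval D e s) # tr1" "eval D e s \<noteq> IntV 0" "exec D I S1 s h tr1 r"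
  | tr1 where "tr = EvGuard (eval D e s) # tr1" "eval D e s = IntV 0" "exec D I S2 s h tr1 r"
  using assms by (rule exec_IfE) metis+

section \<open>Complete executions\<close>

text \<open>For the encoding only results matter, and its events differ from those of the program
  anyway. Without the trace, the semantics becomes a set of rewrite rules that execute the encoded
  code symbolically.\<close>

definition yields ::
  "obj \<Rightarrow> interp \<Rightarrow> stmt \<Rightarrow> stack \<Rightarrow> heap \<Rightarrow> outcome \<Rightarrow> stack \<Rightarrow> heap \<Rightarrow> bool" where
  "yields D I S s h b s1 h1 \<longleftrightarrow> (\<exists>tr. exec D I S s h tr (Fin b s1 h1))"

lemma yields_Assign [simp]:
  "yields D I (Assign x e) s h b s1 h1 \<longleftrightarrow> b = Top \<and> s1 = s(x := eval D e s) \<and> h1 = h"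
  unfolding yields_def by (auto elim: exec_AssignE intro: assign)

lemma yields_Skip [simp]: "yields D I Skip s h b s1 h1 \<longleftrightarrow> b = Top \<and> s1 = s \<and> h1 = h"
  unfolding yields_def by (auto elim: exec_SkipE intro: skip)

lemma yields_Assume [simp]:
  "yields D I (Assume e) s h b s1 h1 \<longleftrightarrow> eval D e s \<noteq> IntV 0 \<and> b = Top \<and> s1 = s \<and> h1 = h"
  unfolding yields_def by (auto elim: exec_AssumeE intro: assume_ok)

lemma yields_Assert [simp]:
  "yields D I (Assert e) s h b s1 h1 \<longleftrightarrow>
     b = (if eval D e s \<noteq> IntV 0 then Top else Bot FSym []) \<and> s1 = s \<and> h1 = h"
  unfolding yields_def by (auto elim: exec_AssertE intro: assert_ok assert_fail)

lemma yields_AssumeP [simp]: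
  "yields D I (AssumeP P es) s h b s1 h1 \<longleftrightarrow>
     map (\<lambda>e. eval D e s) es \<in> I P \<and> b = Top \<and> s1 = s \<and> h1 = h"
  unfolding yields_def by (auto elim: exec_AssumePE intro: assumeP_ok)

lemma yields_AssertP [simp]:
  "yields D I (AssertP P es) s h b s1 h1 \<longleftrightarrow>
     b = (if map (\<lambda>e. eval D e s) es \<in> I P then Top else Bot (Pred P) (map (\<lambda>e. eval D e s) es)) \<and>
     s1 = s \<and> h1 = h"
  unfolding yields_def by (auto elim: exec_AssertPE intro: assertP_ok assertP_fail)

lemma yields_Seq [simp]:
  "yields D I (S1 ;; S2) s h b s1 h1 \<longleftrightarrow>
     (\<exists>s2 h2. yields D I S1 s h Top s2 h2 \<and> yields D I S2 s2 h2 b s1 h1) \<or>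
     (b \<noteq> Top \<and> yields D I S1 s h b s1 h1)"
  unfolding yields_def by (fastforce elim: exec_SeqE intro: seq seq_abort)

lemma yields_If [simp]:
  "yields D I (If e S1 S2) s h b s1 h1 \<longleftrightarrow>
     (if eval D e s = IntV 0 then yields D I S2 s h b s1 h1 else yields D I S1 s h b s1 h1)"
  unfolding yields_def by (auto elim!: exec_IfE) (blast intro: if_true if_false)+

lemma yields_While:
  "yields D I (While e S) s h b s1 h1 \<longleftrightarrow> yields D I (If e (S ;; While e S) Skip) s h b s1 h1"
  unfolding yields_def by (fastforce elim: exec_WhileE intro: while)

text \<open>The derivation for a loop passes through \<open>If\<close> and \<open>Seq\<close>, so
  rule induction would leave the shape \<open>While e S\<close>. The length of the trace serves as
  the measure instead: each iteration records its guard.\<close>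

lemma yields_While_induct [consumes 1, case_names exit abort step]:
  assumes "yields D I (While e S) s h b s1 h1"
    and exit: "\<And>s h. eval D e s = IntV 0 \<Longrightarrow> Q s h Top s h"
    and abort: "\<And>s h b s1 h1. eval D e s \<noteq> IntV 0 \<Longrightarrow> yields D I S s h b s1 h1 \<Longrightarrow> b \<noteq> Top \<Longrightarrow>
      Q s h b s1 h1"
    and step: "\<And>s h s2 h2 b s1 h1. eval D e s \<noteq> IntV 0 \<Longrightarrow> yields D I S s h Top s2 h2 \<Longrightarrow>
      Q s2 h2 b s1 h1 \<Longrightarrow> Q s h b s1 h1"
  shows "Q s h b s1 h1"
proof -
  have "Q s h b s1 h1" if "exec D I (While e S) s h tr (Fin b s1 h1)" for tr s h
    using that
  proof (induction "length tr" arbitrary: tr s h rule: less_induct)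
    case less
    from less.prems have i: "exec D I (If e (S ;; While e S) Skip) s h tr (Fin b s1 h1)"
      by (auto elim: exec_WhileE)
    show ?case
    proof (cases "eval D e s = IntV 0")
      case True
      with i show ?thesis by (auto elim!: exec_IfE exec_SkipE intro: exit)
    next
      case False
      with i obtain tr' where tr: "tr = EvGuard (eval D e s) # tr'"
        and b: "exec D I (S ;; While e S) s h tr' (Fin b s1 h1)"
        by (auto elim!: exec_IfE)
      from b show ?thesis
      proof (cases rule: exec_Seq_cases)
        case (ok tr1 s2 h2 tr2)
        with False less.hyps[of tr2 s2 h2] tr show ?thesis
          by (intro step[of s h s2 h2]) (auto simp: yields_def)
      next
        case fail
        with False show ?thesis by (intro abort) (auto simp: yields_def)
      qed simp
    qed
  qed
  with assms(1) show ?thesis by (auto simp: yields_def)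
qed

lemma safe_iff:
  "safe p \<longleftrightarrow> (\<exists>I \<in> interps p. \<forall>s \<in> stacks p. \<forall>P vs s' h'.
     \<not> yields (def_obj p) I (body p) s [] (Bot P vs) s' h')"
  by (simp add: safe_def delta_eq_Some_iff yields_def emptyHeap_def)

lemma yields_unassigned:
  assumes "yields D I S s h b s1 h1" and "y \<notin> assigned S"
  shows "s1 y = s y"
proof -
  have "s1 y = s y" if "exec D I S s h tr r" "r = Fin b s1 h1" "y \<notin> assigned S" for tr r
    using that by (induction arbitrary: b s1 h1 rule: exec.induct) auto
  with assms show ?thesis by (auto simp: yields_def)
qed

lemma eval_cong: "(\<And>x. x \<in> vars_exp e \<Longrightarrow> s x = s' x) \<Longrightarrow> eval D e s = eval D e s'"
  by (induction e) (auto cong: map_cong, force)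

section \<open>Executions form a chain\<close>

text \<open>Comparability alone is not inductive for \<open>Seq\<close>: when one run has finished
  the first statement and the other is cut inside it, the latter has to be the shorter one. The two
  implications supply this, since a proper result makes the trace maximal.\<close>

lemma exec_chain_strong:
  assumes "exec D I S s h tr r" and "exec D I S s h tr' r'"
  shows "(prefix tr tr' \<or> prefix tr' tr) \<and> (r \<noteq> Cut \<longrightarrow> prefix tr' tr) \<and> (r' \<noteq> Cut \<longrightarrow> prefix tr tr')"
  using assms
proof (induction arbitrary: tr' r' rule: exec.induct)
  case (seq S1 s h tr1 s1 h1 S2 tr2 r)
  from seq.prems show ?case
  proof (cases rule: exec_Seq_cases)
    case (ok tr1' s1' h1' tr2')
    with exec_deterministic[OF seq.hyps(1) ok(2)] seq.IH(2) show ?thesis by auto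
  next
    case fail
    with seq.IH(1)[OF fail(1)] exec_deterministic[OF seq.hyps(1) fail(1)]
    show ?thesis by (cases "r' = Cut") (auto intro: prefix_prefix)
  qed simp
next
  case (seq_abort S1 s h tr r S2)
  from seq_abort.prems show ?case
  proof (cases rule: exec_Seq_cases)
    case (ok tr1' s1' h1' tr2')
    with seq_abort.IH[OF ok(2)] exec_deterministic[OF seq_abort.hyps(1) ok(2)] seq_abort.hyps(2)
    show ?thesis by (cases "r = Cut") (auto intro: prefix_prefix)
  next
    case fail
    with seq_abort.IH show ?thesis by blast
  qed simp
next
  case (while e S s h tr r)
  from while.prems show ?case
    by (rule exec_WhileE) (simp, use while.IH in blast)
next
  case (if_true v e s S1 h tr r S2)
  from if_true.prems show ?case
    by (cases rule: exec_If_cases) (use if_true.IH if_true.hyps in simp_all)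
next
  case (if_false v e s S2 h tr r S1)
  from if_false.prems show ?case
    by (cases rule: exec_If_cases) (use if_false.IH if_false.hyps in simp_all)
next
  case (cut S s h) then show ?case by simp
qed (auto elim!: exec_primE)

lemma exec_chain:
  assumes "exec D I S s h tr r" and "exec D I S s h tr' r'"
  shows "prefix tr tr' \<or> prefix tr' tr"
  using exec_chain_strong[OF assms] by blast

section \<open>Well-typed executions\<close>

definition typed_stack :: "adt \<Rightarrow> (vname \<Rightarrow> ty) \<Rightarrow> stack \<Rightarrow> bool" where
  "typed_stack C G s \<longleftrightarrow> (\<forall>x. has_type C (s x) (G x))"

definition typed_heap :: "adt \<Rightarrow> heap \<Rightarrow> bool" where
  "typed_heap C h \<longleftrightarrow> (\<forall>x \<in> set h. has_type C (ObjV x) TObj)"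

text \<open>Types are tracked for the objects that are read, which have to enter \<open>R\<close>
  and be producible by a havoc, and for the tuples that are tested against a predicate.\<close>

fun typed_event :: "adt \<Rightarrow> (pname \<Rightarrow> ty list) \<Rightarrow> event \<Rightarrow> bool" where
  "typed_event C A (EvRead x a v) \<longleftrightarrow> has_type C (ObjV v) TObj"
| "typed_event C A (EvPred P vs) \<longleftrightarrow> list_all2 (has_type C) vs (A P)"
| "typed_event C A _ \<longleftrightarrow> True"

fun typed_result :: "adt \<Rightarrow> (vname \<Rightarrow> ty) \<Rightarrow> result \<Rightarrow> bool" where
  "typed_result C G (Fin b s h) \<longleftrightarrow> typed_stack C G s \<and> typed_heap C h"
| "typed_result C G Cut \<longleftrightarrow> True"

lemma has_type_TInt [simp]: "has_type C v TInt \<longleftrightarrow> (\<exists>n. v = IntV n)"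
  by (cases v) auto

lemma has_type_TAddr [simp]: "has_type C v TAddr \<longleftrightarrow> (\<exists>n \<ge> 0. v = IntV n)"
  by (cases v) auto

lemma has_type_TObj:
  "has_type C v TObj \<longleftrightarrow> (\<exists>k fs. v = ObjV (Obj k fs) \<and> k < length C \<and>
     length fs = length (C ! k) \<and> (\<forall>i < length fs. C ! k ! i = TAddr \<longrightarrow> 0 \<le> fs ! i))"
  by (cases "(C, v, TObj)" rule: has_type.cases) (auto simp: list_all2_conv_all_nth)

lemma has_type_obj_of: "has_type C v TObj \<Longrightarrow> ObjV (obj_of v) = v"
  by (auto simp: has_type_TObj)

lemma nonrecursiveD: "nonrecursive C \<Longrightarrow> k < length C \<Longrightarrow> i < length (C ! k) \<Longrightarrow> C ! k ! i \<noteq> TObj"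
  unfolding nonrecursive_def by (metis nth_mem)

lemma eval_has_type:
  assumes "wt_exp C G e t" and "typed_stack C G s" and "has_type C (ObjV D) TObj" and "nonrecursive C"
  shows "has_type C (eval D e s) t"
  using assms
proof (induction rule: wt_exp.induct)
  case (9 k es)
  then have *: "length es = length (C ! k)" "\<And>i. i < length es \<Longrightarrow> has_type C (eval D (es ! i) s) (C ! k ! i)"
    by (auto simp: list_all2_conv_all_nth)
  have "0 \<le> int_of (eval D (es ! i) s)" if "i < length es" "C ! k ! i = TAddr" for i
    using *(2)[OF that(1)] that(2) by auto
  with 9 * show ?case by (auto simp: has_type_TObj)
next
  case (10 k i e)
  then obtain k' fs where "eval D e s = ObjV (Obj k' fs)" "length fs = length (C ! k')"
    "\<forall>i < length fs. C ! k' ! i = TAddr \<longrightarrow> 0 \<le> fs ! i"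
    by (auto simp: has_type_TObj)
  with 10 nonrecursiveD[of C k i] show ?case by (cases "C ! k ! i") auto
qed (auto simp: typed_stack_def)

lemma eval_list_has_type:
  assumes "list_all2 (wt_exp C G) es ts" and "typed_stack C G s" and "has_type C (ObjV D) TObj"
    and "nonrecursive C"
  shows "list_all2 (has_type C) (map (\<lambda>e. eval D e s) es) ts"
  using assms eval_has_type[of C G _ _ s D] by (simp add: list_all2_conv_all_nth)

lemma typed_heap_read:
  "typed_heap C h \<Longrightarrow> has_type C (ObjV D) TObj \<Longrightarrow> has_type C (ObjV (heap_read D h a)) TObj"
  by (auto simp: heap_read_def typed_heap_def)

lemma typed_heap_write:
  "typed_heap C h \<Longrightarrow> has_type C (ObjV v) TObj \<Longrightarrow> typed_heap C (heap_write h a v)"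
  using set_update_subset_insert[of h "nat (a - 1)" v] by (auto simp: heap_write_def typed_heap_def)

lemma typed_stack_upd: "typed_stack C G s \<Longrightarrow> has_type C v (G x) \<Longrightarrow> typed_stack C G (s(x := v))"
  by (simp add: typed_stack_def)

inductive_cases wt_AssignE: "wt_stmt C A G (Assign x e)"
inductive_cases wt_AllocE: "wt_stmt C A G (Alloc q e)"
inductive_cases wt_ReadE: "wt_stmt C A G (Read x q)"
inductive_cases wt_WriteE: "wt_stmt C A G (Write q e)"
inductive_cases wt_SeqE: "wt_stmt C A G (S1 ;; S2)"
inductive_cases wt_IfE: "wt_stmt C A G (If e S1 S2)"
inductive_cases wt_WhileE: "wt_stmt C A G (While e S)"
inductive_cases wt_AssumeE: "wt_stmt C A G (Assume e)"
inductive_cases wt_AssertE: "wt_stmt C A G (Assert e)"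
inductive_cases wt_AssumePE: "wt_stmt C A G (AssumeP P es)"
inductive_cases wt_AssertPE: "wt_stmt C A G (AssertP P es)"

lemma wt_While_unfold: "wt_stmt C A G (While e S) \<Longrightarrow> wt_stmt C A G (If e (S ;; While e S) Skip)"
  by (erule wt_WhileE) (intro wt_stmt.intros)

lemma exec_typed:
  assumes "exec D I S s h tr r" and "wt_stmt C A G S"
    and "typed_stack C G s" and "typed_heap C h" and "has_type C (ObjV D) TObj" and "nonrecursive C"
  shows "(\<forall>ev \<in> set tr. typed_event C A ev) \<and> typed_result C G r"
  using assms
proof (induction rule: exec.induct)
  case (assign v e s x h)
  then show ?case by (auto elim!: wt_AssignE intro!: typed_stack_upd eval_has_type)
next
  case (alloc v e s h h' a q)
  then have "has_type C (ObjV v) TObj"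
    using eval_has_type[of C G e TObj s D] by (auto elim!: wt_AllocE simp: has_type_obj_of)
  with alloc show ?case
    by (auto elim!: wt_AllocE intro!: typed_stack_upd simp: allocate_def typed_heap_def)
next
  case (load a s q v h x)
  then show ?case by (auto elim!: wt_ReadE intro!: typed_stack_upd typed_heap_read)
next
  case (store a s q v e h)
  then have "has_type C (ObjV v) TObj"
    using eval_has_type[of C G e TObj s D] by (auto elim!: wt_WriteE simp: has_type_obj_of)
  with store show ?case by (auto intro!: typed_heap_write)
next
  case (while e S s h tr r)
  then show ?case by (blast dest: wt_While_unfold)
next
  case (seq_abort S1 s h tr r S2)
  then show ?case by (auto elim!: wt_SeqE)
next
  case (assumeP_ok vs s es P h)
  then show ?case by (auto elim!: wt_AssumePE intro: eval_list_has_type)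
next
  case (assumeP_fail vs s es P h)
  then show ?case by (auto elim!: wt_AssumePE intro: eval_list_has_type)
next
  case (assertP_ok vs s es P h)
  then show ?case by (auto elim!: wt_AssertPE intro: eval_list_has_type)
next
  case (assertP_fail vs s es P h)
  then show ?case by (auto elim!: wt_AssertPE intro: eval_list_has_type)
qed (auto elim!: wt_SeqE wt_IfE)

section \<open>Renaming addresses\<close>

text \<open>At run time an address cannot be told from an integer, so the declared type of a field
  decides whether it is renamed.\<close>

fun ren_obj :: "adt \<Rightarrow> (int \<Rightarrow> int) \<Rightarrow> obj \<Rightarrow> obj" where
  "ren_obj C f (Obj k fs) =
     Obj k (map (\<lambda>i. if C ! k ! i = TAddr then f (fs ! i) else fs ! i) [0..<length fs])"

fun ren_val :: "adt \<Rightarrow> (int \<Rightarrow> int) \<Rightarrow> ty \<Rightarrow> val \<Rightarrow> val" where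
  "ren_val C f t (IntV n) = IntV (if t = TAddr then f n else n)"
| "ren_val C f t (ObjV x) = ObjV (if t = TObj then ren_obj C f x else x)"

lemma ren_val_TInt [simp]: "ren_val C f TInt v = v"
  by (cases v) simp_all

definition ren_stack :: "adt \<Rightarrow> (vname \<Rightarrow> ty) \<Rightarrow> (int \<Rightarrow> int) \<Rightarrow> stack \<Rightarrow> stack" where
  "ren_stack C G f s = (\<lambda>x. ren_val C f (G x) (s x))"

fun ren_event :: "adt \<Rightarrow> (pname \<Rightarrow> ty list) \<Rightarrow> (vname \<Rightarrow> ty) \<Rightarrow> (int \<Rightarrow> int) \<Rightarrow> event \<Rightarrow> event" where
  "ren_event C A G f (EvAssign x v) = EvAssign x (ren_val C f (G x) v)"
| "ren_event C A G f (EvAlloc q a v) = EvAlloc q (f a) (ren_obj C f v)"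
| "ren_event C A G f (EvRead x a v) = EvRead x (f a) (ren_obj C f v)"
| "ren_event C A G f (EvWrite q a v) = EvWrite q (f a) (ren_obj C f v)"
| "ren_event C A G f (EvPred P vs) =
     EvPred P (map (\<lambda>i. ren_val C f (A P ! i) (vs ! i)) [0..<length vs])"
| "ren_event C A G f ev = ev"

fun ren_result :: "adt \<Rightarrow> (vname \<Rightarrow> ty) \<Rightarrow> (int \<Rightarrow> int) \<Rightarrow> result \<Rightarrow> result" where
  "ren_result C G f (Fin b s h) = Fin b (ren_stack C G f s) (map (ren_obj C f) h)"
| "ren_result C G f Cut = Cut"

lemma ren_obj_common:
  assumes fg: "\<And>a b. f a = g b \<Longrightarrow> f a = a" and "ren_obj C f x = ren_obj C g x"
  shows "ren_obj C f x = x"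
proof (cases x)
  case (Obj k fs)
  have "map (\<lambda>i. if C ! k ! i = TAddr then f (fs ! i) else fs ! i) [0..<length fs] =
      map ((!) fs) [0..<length fs]"
  proof (rule map_cong)
    fix i
    assume i: "i \<in> set [0..<length fs]"
    show "(if C ! k ! i = TAddr then f (fs ! i) else fs ! i) = fs ! i"
    proof (cases "C ! k ! i = TAddr")
      case True
      with assms(2) Obj i have "f (fs ! i) = g (fs ! i)" by (auto dest: bspec[of _ _ i])
      from fg[OF this] show ?thesis by (metis (full_types))
    qed simp
  qed simp
  with Obj show ?thesis by (simp add: map_nth)
qed

lemma ren_val_common:
  assumes fg: "\<And>a b. f a = g b \<Longrightarrow> f a = a" and eq: "ren_val C f t v = ren_val C g t v"
  shows "ren_val C f t v = v"
proof (cases v)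
  case (IntV n)
  with eq fg[of n n] show ?thesis by (cases "t = TAddr") simp_all
next
  case (ObjV x)
  with eq ren_obj_common[where f=f and g=g and C=C and x=x, OF fg] show ?thesis by (cases "t = TObj") simp_all
qed

text \<open>Meant for renamings whose ranges meet only in fixed points: an event on which they agree
  cannot contain an address that is moved.\<close>

lemma ren_event_common:
  assumes fg: "\<And>a b. f a = g b \<Longrightarrow> f a = a" and eq: "ren_event C A G f ev = ren_event C A G g ev"
  shows "ren_event C A G f ev = ev"
proof (cases ev)
  case (EvPred P vs)
  have "map (\<lambda>i. ren_val C f (A P ! i) (vs ! i)) [0..<length vs] = map ((!) vs) [0..<length vs]"
  proof (rule map_cong)
    fix i
    assume "i \<in> set [0..<length vs]"
    with eq EvPred have "ren_val C f (A P ! i) (vs ! i) = ren_val C g (A P ! i) (vs ! i)" by simp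
    from ren_val_common[OF fg this] show "ren_val C f (A P ! i) (vs ! i) = vs ! i" .
  qed simp
  with EvPred show ?thesis by (simp add: map_nth)
qed (use eq fg[of _ _] ren_obj_common[where f=f and g=g and C=C, OF fg] ren_val_common[where f=f and g=g and C=C, OF fg] in simp_all)

lemma ren_obj_inj:
  assumes "inj f" and eq: "ren_obj C f x = ren_obj C f y"
  shows "x = y"
proof -
  obtain k fs k' gs where xy: "x = Obj k fs" "y = Obj k' gs" by (metis obj.exhaust)
  have len: "length fs = length gs"
    using eq xy by (auto dest: map_eq_imp_length_eq)
  have "fs ! i = gs ! i" if "i < length fs" for i
    using eq xy len that
    by (cases "C ! k ! i = TAddr") (auto simp: inj_eq[OF assms(1)] dest!: bspec[of _ _ i])
  with xy len eq show ?thesis by (auto intro: nth_equalityI)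
qed

lemma ren_val_inj:
  assumes "inj f"
  shows "ren_val C f t v = ren_val C f t w \<longleftrightarrow> v = w"
proof -
  have "ren_obj C f x = ren_obj C f y \<longleftrightarrow> x = y" for x y
    using ren_obj_inj[OF assms] by blast
  then show ?thesis
    using injD[OF assms] by (cases v; cases w) auto
qed

lemma int_of_ren: "f 0 = 0 \<Longrightarrow> int_of (ren_val C f t v) = (if t = TAddr then f (int_of v) else int_of v)"
  by (cases v) auto

lemma obj_of_ren: "obj_of (ren_val C f TObj v) = ren_obj C f (obj_of v)"
  by (cases v) auto

text \<open>Addresses are inspected by equality only, which injectivity preserves.
  \<open>f 0 = 0\<close> accounts for null and for the value 0 of a selector applied to the wrong
  constructor, the last hypothesis for \<open>DefObj\<close>.\<close>

lemma eval_ren: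
  assumes "wt_exp C G e t" and "inj f" and "f 0 = 0" and "ren_obj C f D = D"
  shows "eval D e (ren_stack C G f s) = ren_val C f t (eval D e s)"
  using assms
proof (induction rule: wt_exp.induct)
  case (8 e1 t e2)
  then show ?case by (simp add: ren_val_inj)
next
  case (9 k es)
  have "map (\<lambda>e. int_of (eval D e (ren_stack C G f s))) es =
      map (\<lambda>i. if C ! k ! i = TAddr then f (map (\<lambda>e. int_of (eval D e s)) es ! i)
        else map (\<lambda>e. int_of (eval D e s)) es ! i) [0..<length es]"
  proof (rule nth_equalityI)
    fix i
    assume "i < length (map (\<lambda>e. int_of (eval D e (ren_stack C G f s))) es)"
    then have i: "i < length es" by simp
    with 9 have "eval D (es ! i) (ren_stack C G f s) = ren_val C f (C ! k ! i) (eval D (es ! i) s)"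
      by (simp add: list_all2_conv_all_nth)
    with i 9 show "map (\<lambda>e. int_of (eval D e (ren_stack C G f s))) es ! i =
      map (\<lambda>i. if C ! k ! i = TAddr then f (map (\<lambda>e. int_of (eval D e s)) es ! i)
        else map (\<lambda>e. int_of (eval D e s)) es ! i) [0..<length es] ! i"
      by (simp add: int_of_ren)
  qed simp
  then show ?case by simp
next
  case (10 k i e)
  then show ?case by (cases "obj_of (eval D e s)") (simp add: obj_of_ren)
next
  case (11 k e)
  then show ?case by (cases "obj_of (eval D e s)") (simp add: obj_of_ren)
qed (simp_all add: ren_stack_def int_of_ren)

lemma eval_list_ren:
  assumes "list_all2 (wt_exp C G) es ts" and "inj f" and "f 0 = 0" and "ren_obj C f D = D"
  shows "map (\<lambda>e. eval D e (ren_stack C G f s)) es =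
    map (\<lambda>i. ren_val C f (ts ! i) (map (\<lambda>e. eval D e s) es ! i)) [0..<length es]"
proof (rule nth_equalityI)
  fix i
  assume "i < length (map (\<lambda>e. eval D e (ren_stack C G f s)) es)"
  then have i: "i < length es" by simp
  with assms(1) have "wt_exp C G (es ! i) (ts ! i)" by (simp add: list_all2_conv_all_nth)
  from eval_ren[OF this assms(2-4)] i
  show "map (\<lambda>e. eval D e (ren_stack C G f s)) es ! i =
    map (\<lambda>i. ren_val C f (ts ! i) (map (\<lambda>e. eval D e s) es ! i)) [0..<length es] ! i"
    by simp
qed simp

lemma ren_stack_upd: "ren_stack C G f (s(x := v)) = (ren_stack C G f s)(x := ren_val C f (G x) v)"
  by (auto simp: ren_stack_def)

lemma int_of_ren_stack:
  "G q = TAddr \<Longrightarrow> f 0 = 0 \<Longrightarrow> int_of (ren_stack C G f s q) = f (int_of (s q))"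
  by (simp add: ren_stack_def int_of_ren)

text \<open>If \<open>f a\<close> lies in the interval, then \<open>f (f a) = f a\<close>, and
  injectivity gives \<open>f a = a\<close>. Hence an access out of bounds stays out of
  bounds.\<close>

lemma ren_in_bounds:
  fixes m :: nat
  assumes "inj f" and "\<And>a. 0 \<le> a \<Longrightarrow> a \<le> int m \<Longrightarrow> f a = a"
  shows "0 < f a \<and> f a \<le> int m \<longleftrightarrow> 0 < a \<and> a \<le> int m"
proof
  assume "0 < f a \<and> f a \<le> int m"
  with assms(2)[of "f a"] injD[OF assms(1), of "f a" a] show "0 < a \<and> a \<le> int m" by simp
qed (use assms(2)[of a] in simp)

lemma ren_heap_read:
  assumes "inj f" and "\<And>a. 0 \<le> a \<Longrightarrow> a \<le> int (length h) \<Longrightarrow> f a = a" and "ren_obj C f D = D"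
  shows "heap_read D (map (ren_obj C f) h) (f a) = ren_obj C f (heap_read D h a)"
  using ren_in_bounds[of f "length h" a] assms by (auto simp: heap_read_def)

lemma ren_heap_write:
  assumes "inj f" and "\<And>a. 0 \<le> a \<Longrightarrow> a \<le> int (length h) \<Longrightarrow> f a = a"
  shows "heap_write (map (ren_obj C f) h) (f a) (ren_obj C f v) = map (ren_obj C f) (heap_write h a v)"
  using ren_in_bounds[of f "length h" a] assms by (auto simp: heap_write_def map_update)

text \<open>Every allocation leaves an event, so the trace bounds the addresses that a run can
  allocate, and thereby what a renaming has to fix.\<close>

lemma exec_heap_length:
  "exec D I S s h tr r \<Longrightarrow> r = Fin b s1 h1 \<Longrightarrow> length h1 \<le> length h + length tr"
  by (induction arbitrary: b s1 h1 rule: exec.induct) (force simp: allocate_def heap_write_def)+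

lemma exec_SeqI_first: "exec D I S1 s h tr r \<Longrightarrow> \<exists>r'. exec D I (S1 ;; S2) s h tr r'"
  using exec.seq[OF _ exec.cut, of D I S1 s h tr] by (cases "\<exists>s1 h1. r = Fin Top s1 h1") (auto intro: exec.seq_abort)

text \<open>With \<open>c\<close> a renaming of addresses, nothing can be said beyond the first event that \<open>c\<close> changes,
  as interpretations need not be invariant under renaming.\<close>

definition shadowed :: "(event list \<Rightarrow> result \<Rightarrow> bool) \<Rightarrow> (event \<Rightarrow> event) \<Rightarrow> event list \<Rightarrow> result \<Rightarrow> bool" where
  "shadowed E c tr r \<longleftrightarrow> (\<forall>ev \<in> set tr. c ev = ev) \<and> E tr r \<or>
     (\<exists>tr0 ev tr1 r'. tr = tr0 @ ev # tr1 \<and> (\<forall>ev \<in> set tr0. c ev = ev) \<and> c ev \<noteq> ev \<and> E (tr0 @ [c ev]) r')"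

lemma shadowed_Nil: "E [] r \<Longrightarrow> shadowed E c [] r"
  by (simp add: shadowed_def)

lemma shadowed_single:
  assumes "E [c ev] r'" and "c ev = ev \<Longrightarrow> r' = r"
  shows "shadowed E c [ev] r"
proof (cases "c ev = ev")
  case False
  have "[ev] = [] @ ev # []" by simp
  with False assms(1) show ?thesis unfolding shadowed_def by (metis append_Nil empty_iff empty_set)
qed (use assms in \<open>simp add: shadowed_def\<close>)

lemma shadowed_append_left:
  assumes "shadowed E c tr r" and "\<forall>ev \<in> set tr1. c ev = ev"
    and "\<And>tr r. E tr r \<Longrightarrow> E' (tr1 @ tr) r"
  shows "shadowed E' c (tr1 @ tr) r"
  using assms(1) unfolding shadowed_def
proof (elim disjE exE conjE)
  fix tr0 ev tr2 r'
  assume *: "tr = tr0 @ ev # tr2" "\<forall>ev \<in> set tr0. c ev = ev" "c ev \<noteq> ev" "E (tr0 @ [c ev]) r'"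
  with assms(2,3) have "tr1 @ tr = (tr1 @ tr0) @ ev # tr2" "\<forall>ev \<in> set (tr1 @ tr0). c ev = ev"
    "E' ((tr1 @ tr0) @ [c ev]) r'" by auto
  with *(3) show "(\<forall>ev \<in> set (tr1 @ tr). c ev = ev) \<and> E' (tr1 @ tr) r \<or>
     (\<exists>tr0 ev tr2 r'. tr1 @ tr = tr0 @ ev # tr2 \<and> (\<forall>ev \<in> set tr0. c ev = ev) \<and> c ev \<noteq> ev \<and>
       E' (tr0 @ [c ev]) r')" by blast
qed (use assms in auto)

lemma shadowed_Cons:
  "shadowed E c tr r \<Longrightarrow> c ev = ev \<Longrightarrow> (\<And>tr r. E tr r \<Longrightarrow> E' (ev # tr) r) \<Longrightarrow>
    shadowed E' c (ev # tr) r"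
  using shadowed_append_left[of E c tr r "[ev]" E'] by simp

text \<open>If the renamed run departs within \<open>tr1\<close> already, nothing needs to be known
  about what follows.\<close>

lemma shadowed_append_right:
  assumes "shadowed E c tr1 r1"
    and "E tr1 r1 \<Longrightarrow> \<forall>ev \<in> set tr1. c ev = ev \<Longrightarrow> shadowed E' c (tr1 @ tr2) r"
    and "\<And>tr r. E tr r \<Longrightarrow> \<exists>r'. E' tr r'"
  shows "shadowed E' c (tr1 @ tr2) r"
proof (cases "(\<forall>ev \<in> set tr1. c ev = ev) \<and> E tr1 r1")
  case False
  with assms(1) obtain tr0 ev tr' r' where *: "tr1 = tr0 @ ev # tr'" "\<forall>ev \<in> set tr0. c ev = ev"
    "c ev \<noteq> ev" "E (tr0 @ [c ev]) r'"
    unfolding shadowed_def by blast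
  then have "tr1 @ tr2 = tr0 @ ev # (tr' @ tr2)" by simp
  with * assms(3) show ?thesis unfolding shadowed_def by blast
qed (use assms in blast)

lemma shadowed_mono:
  "shadowed E c tr r \<Longrightarrow> (\<And>tr r. E tr r \<Longrightarrow> E' tr r) \<Longrightarrow> shadowed E' c tr r"
  using shadowed_append_left[of E c tr r "[]" E'] by simp

text \<open>The event is emitted whether or not the test succeeds. This is all that can be said when
  a renaming has changed the tuple, as its membership in \<open>I P\<close> is then unknown.\<close>

lemma exec_AssumeP:
  "exec D I (AssumeP P es) s h [EvPred P (map (\<lambda>e. eval D e s) es)]
     (if map (\<lambda>e. eval D e s) es \<in> I P then Fin Top s h else Cut)"
  by (auto intro: assumeP_ok assumeP_fail)

lemma exec_AssertP:
  "exec D I (AssertP P es) s h [EvPred P (map (\<lambda>e. eval D e s) es)]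
     (if map (\<lambda>e. eval D e s) es \<in> I P then Fin Top s h
      else Fin (Bot (Pred P) (map (\<lambda>e. eval D e s) es)) s h)"
  by (auto intro: assertP_ok assertP_fail)

text \<open>Expressions commute with the renaming by \<open>eval_ren\<close>, heap accesses because
  \<open>f\<close> fixes every address the run can allocate. Only a predicate can tell renamed
  values apart; but then the tuple, and with it the event, has changed, which is where
  \<open>shadowed\<close> stops.\<close>

lemma exec_ren:
  assumes "exec D I S s h tr r" and "wt_stmt C A G S"
    and "inj f" and "ren_obj C f D = D"
    and "\<And>a. 0 \<le> a \<Longrightarrow> a \<le> int (length h + length tr) \<Longrightarrow> f a = a"
  shows "shadowed (exec D I S (ren_stack C G f s) (map (ren_obj C f) h)) (ren_event C A G f) tr
    (ren_result C G f r)"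
  using assms
proof (induction rule: exec.induct)
  case (cut S s h)
  show ?case by (auto intro: shadowed_Nil exec.cut)
next
  case (skip s h)
  show ?case by (auto intro: shadowed_Nil exec.skip)
next
  case (assign v e s x h)
  then show ?case
    using eval_ren[of C G e "G x" f D s]
    by (auto elim!: wt_AssignE simp: ren_stack_upd intro!: shadowed_single exec.assign)
next
  case (alloc v e s h h' a q)
  then show ?case
    using eval_ren[of C G e TObj f D s]
    by (auto elim!: wt_AllocE simp: ren_stack_upd allocate_def obj_of_ren
        intro!: shadowed_single exec.alloc)
next
  case (load a s q v h x)
  then show ?case
    using ren_heap_read[of f h C D a]
    by (auto elim!: wt_ReadE simp: ren_stack_upd int_of_ren_stack intro!: shadowed_single exec.load)
next
  case (store a s q v e h)
  then show ?case
    using ren_heap_write[of f h C a v] eval_ren[of C G e TObj f D s]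
      exec.store[of "f a" "ren_stack C G f s" q "ren_obj C f v" D e I "map (ren_obj C f) h"]
    by (auto elim!: wt_WriteE simp: obj_of_ren int_of_ren_stack intro!: shadowed_single)
next
  case (seq S1 s h tr1 s1 h1 S2 tr2 r)
  have wt: "wt_stmt C A G S1" "wt_stmt C A G S2" using seq.prems(1) by (auto elim: wt_SeqE)
  show ?case
  proof (rule shadowed_append_right)
    show "shadowed (exec D I S1 (ren_stack C G f s) (map (ren_obj C f) h)) (ren_event C A G f) tr1
        (ren_result C G f (Fin Top s1 h1))"
      by (rule seq.IH(1)) (use wt seq.prems in auto)
    have "shadowed (exec D I S2 (ren_stack C G f s1) (map (ren_obj C f) h1)) (ren_event C A G f) tr2
        (ren_result C G f r)"
      by (rule seq.IH(2)) (use wt seq.prems exec_heap_length[OF seq.hyps(1)] in auto)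
    then show "shadowed (exec D I (S1 ;; S2) (ren_stack C G f s) (map (ren_obj C f) h))
        (ren_event C A G f) (tr1 @ tr2) (ren_result C G f r)"
      if "exec D I S1 (ren_stack C G f s) (map (ren_obj C f) h) tr1 (ren_result C G f (Fin Top s1 h1))"
        "\<forall>ev \<in> set tr1. ren_event C A G f ev = ev"
      using that by (elim shadowed_append_left) (auto intro: exec.seq)
  qed (rule exec_SeqI_first)
next
  case (seq_abort S1 s h tr r S2)
  have "shadowed (exec D I (S1 ;; S2) (ren_stack C G f s) (map (ren_obj C f) h)) (ren_event C A G f)
      (tr @ []) (ren_result C G f r)"
  proof (rule shadowed_append_right)
    show "shadowed (exec D I S1 (ren_stack C G f s) (map (ren_obj C f) h)) (ren_event C A G f) tr
        (ren_result C G f r)"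
      by (rule seq_abort.IH) (use seq_abort.prems in \<open>auto elim: wt_SeqE\<close>)
    have "\<forall>s1 h1. ren_result C G f r \<noteq> Fin Top s1 h1"
      using seq_abort.hyps(2) by (cases r) auto
    then show "shadowed (exec D I (S1 ;; S2) (ren_stack C G f s) (map (ren_obj C f) h))
        (ren_event C A G f) (tr @ []) (ren_result C G f r)"
      if "exec D I S1 (ren_stack C G f s) (map (ren_obj C f) h) tr (ren_result C G f r)"
        "\<forall>ev \<in> set tr. ren_event C A G f ev = ev"
      using that by (auto simp: shadowed_def intro: exec.seq_abort)
  qed (rule exec_SeqI_first)
  then show ?case by simp
next
  case (if_true v e s S1 h tr r S2)
  have wt: "wt_exp C G e TInt" "wt_stmt C A G S1" using if_true.prems(1) by (auto elim: wt_IfE)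
  have "shadowed (exec D I S1 (ren_stack C G f s) (map (ren_obj C f) h)) (ren_event C A G f) tr
      (ren_result C G f r)"
    by (rule if_true.IH) (use if_true.prems wt in auto)
  then show ?case
  proof (rule shadowed_Cons)
    show "exec D I (If e S1 S2) (ren_stack C G f s) (map (ren_obj C f) h) (EvGuard v # tr) r"
      if "exec D I S1 (ren_stack C G f s) (map (ren_obj C f) h) tr r" for tr r
      using that eval_ren[OF wt(1), of f D s] if_true.prems if_true.hyps by (auto intro: exec.if_true)
  qed simp
next
  case (if_false v e s S2 h tr r S1)
  have wt: "wt_exp C G e TInt" "wt_stmt C A G S2" using if_false.prems(1) by (auto elim: wt_IfE)
  have "shadowed (exec D I S2 (ren_stack C G f s) (map (ren_obj C f) h)) (ren_event C A G f) tr
      (ren_result C G f r)"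
    by (rule if_false.IH) (use if_false.prems wt in auto)
  then show ?case
  proof (rule shadowed_Cons)
    show "exec D I (If e S1 S2) (ren_stack C G f s) (map (ren_obj C f) h) (EvGuard v # tr) r"
      if "exec D I S2 (ren_stack C G f s) (map (ren_obj C f) h) tr r" for tr r
      using that eval_ren[OF wt(1), of f D s] if_false.prems if_false.hyps by (auto intro: exec.if_false)
  qed simp
next
  case (while e S s h tr r)
  show ?case
    by (rule shadowed_mono[OF while.IH[OF wt_While_unfold[OF while.prems(1)] while.prems(2-)] exec.while])
next
  case (assumeP_ok vs s es P h)
  then have "list_all2 (wt_exp C G) es (A P)" by (auto elim: wt_AssumePE)
  from eval_list_ren[OF this, of f D s] assumeP_ok
  have *: "ren_event C A G f (EvPred P vs) = EvPred P (map (\<lambda>e. eval D e (ren_stack C G f s)) es)"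
    by simp
  show ?case
    by (rule shadowed_single, unfold *, rule exec_AssumeP) (use assumeP_ok.hyps in \<open>simp cong: map_cong\<close>)
next
  case (assumeP_fail vs s es P h)
  then have "list_all2 (wt_exp C G) es (A P)" by (auto elim: wt_AssumePE)
  from eval_list_ren[OF this, of f D s] assumeP_fail
  have *: "ren_event C A G f (EvPred P vs) = EvPred P (map (\<lambda>e. eval D e (ren_stack C G f s)) es)"
    by simp
  show ?case
    by (rule shadowed_single, unfold *, rule exec_AssumeP) (use assumeP_fail.hyps in \<open>simp cong: map_cong\<close>)
next
  case (assertP_ok vs s es P h)
  then have "list_all2 (wt_exp C G) es (A P)" by (auto elim: wt_AssertPE)
  from eval_list_ren[OF this, of f D s] assertP_ok
  have *: "ren_event C A G f (EvPred P vs) = EvPred P (map (\<lambda>e. eval D e (ren_stack C G f s)) es)"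
    by simp
  show ?case
    by (rule shadowed_single, unfold *, rule exec_AssertP) (use assertP_ok.hyps in \<open>simp cong: map_cong\<close>)
next
  case (assertP_fail vs s es P h)
  then have "list_all2 (wt_exp C G) es (A P)" by (auto elim: wt_AssertPE)
  from eval_list_ren[OF this, of f D s] assertP_fail
  have *: "ren_event C A G f (EvPred P vs) = EvPred P (map (\<lambda>e. eval D e (ren_stack C G f s)) es)"
    by simp
  show ?case
    by (rule shadowed_single, unfold *, rule exec_AssertP) (use assertP_fail.hyps in \<open>simp cong: map_cong\<close>)
next
  case (assume_ok v e s h)
  then have "wt_exp C G e TInt" by (auto elim: wt_AssumeE)
  from eval_ren[OF this, of f D s] assume_ok show ?case
    by (auto intro!: shadowed_single exec.assume_ok)
next
  case (assume_fail v e s h)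
  then have "wt_exp C G e TInt" by (auto elim: wt_AssumeE)
  from eval_ren[OF this, of f D s] assume_fail show ?case
    by (auto intro!: shadowed_single exec.assume_fail)
next
  case (assert_ok v e s h)
  then have "wt_exp C G e TInt" by (auto elim: wt_AssertE)
  from eval_ren[OF this, of f D s] assert_ok show ?case
    by (auto intro!: shadowed_single exec.assert_ok)
next
  case (assert_fail v e s h)
  then have "wt_exp C G e TInt" by (auto elim: wt_AssertE)
  from eval_ren[OF this, of f D s] assert_fail show ?case
    by (auto intro!: shadowed_single exec.assert_fail)
qed

section \<open>Two renamings of the integers into the naturals\<close>

text \<open>Above \<open>M + 1\<close>, the summand \<open>4 * \<bar>a\<bar>\<close> leaves the two
  lowest binary digits free. That of weight 2 stores the sign of \<open>a\<close>, which gives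
  injectivity; that of weight 1 stores \<open>c\<close>, which keeps the moved addresses for
  \<open>c = 0\<close> and \<open>c = 1\<close> apart.\<close>

definition ren :: "int \<Rightarrow> int \<Rightarrow> int \<Rightarrow> int" where
  "ren c M a = (if 0 \<le> a \<and> a \<le> M then a else M + 1 + 4 * \<bar>a\<bar> + (if a < 0 then 2 else 0) + c)"

lemma ren_fix: "0 \<le> a \<Longrightarrow> a \<le> M \<Longrightarrow> ren c M a = a"
  by (simp add: ren_def)

lemma ren_nonneg: "0 \<le> M \<Longrightarrow> 0 \<le> c \<Longrightarrow> 0 \<le> ren c M a"
  by (auto simp: ren_def)

lemma ren_inj: "0 \<le> M \<Longrightarrow> 0 \<le> c \<Longrightarrow> inj (ren c M)"
  unfolding inj_def ren_def by (auto split: if_splits) presburger+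

lemma ren_common: "0 \<le> M \<Longrightarrow> ren 0 M a = ren 1 M b \<Longrightarrow> ren 0 M a = a"
  unfolding ren_def by (auto split: if_splits) presburger+

definition redeclare_adt :: "adt \<Rightarrow> adt" where
  "redeclare_adt C = map (map redeclare) C"

lemma redeclare_eq_TObj [simp]: "redeclare t = TObj \<longleftrightarrow> t = TObj"
  by (cases t) auto

lemma redeclare_neq_TAddr [simp]: "redeclare t \<noteq> TAddr"
  by (cases t) auto

lemma has_type_redeclare: "has_type C v t \<Longrightarrow> has_type (redeclare_adt C) v (redeclare t)"
  by (cases t) (auto simp: has_type_TObj redeclare_adt_def)

lemma ren_val_has_type:
  assumes "has_type (redeclare_adt C) v (redeclare t)" and "\<And>a. 0 \<le> f a"
  shows "has_type C (ren_val C f t v) t"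
  using assms by (cases t) (auto simp: has_type_TObj redeclare_adt_def)

lemma map_upt_eq_iff: "map g [0..<length xs] = xs \<longleftrightarrow> (\<forall>i < length xs. g i = xs ! i)"
  using map_eq_conv[of g "[0..<length xs]" "(!) xs"] map_nth[of xs] by auto

lemma ren_obj_id_iff:
  "ren_obj C f (Obj k fs) = Obj k fs \<longleftrightarrow> (\<forall>i < length fs. C ! k ! i = TAddr \<longrightarrow> f (fs ! i) = fs ! i)"
  by (auto simp: map_upt_eq_iff)

text \<open>Whether an event is changed depends only on which addresses are moved, so two renamings
  with the same fixed points change the same event first.\<close>

lemma ren_event_id_cong:
  assumes fg: "\<And>a. f a = a \<longleftrightarrow> g a = a"
  shows "ren_event C A G f ev = ev \<longleftrightarrow> ren_event C A G g ev = ev"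
proof -
  have obj: "ren_obj C f x = x \<longleftrightarrow> ren_obj C g x = x" for x
    by (cases x) (simp only: ren_obj_id_iff fg)
  have val: "ren_val C f t v = v \<longleftrightarrow> ren_val C g t v = v" for t v
    by (cases v) (simp_all add: fg obj)
  show ?thesis
    by (cases ev) (simp_all add: fg obj val map_upt_eq_iff)
qed

lemma shadowed_sameD: "shadowed E c tr r \<Longrightarrow> \<forall>ev \<in> set tr. c ev = ev \<Longrightarrow> E tr r"
  unfolding shadowed_def by (metis in_set_conv_decomp)

text \<open>The first changed event of a trace is unique, so the departure described by
  \<open>shadowed\<close> occurs exactly at \<open>ev\<close>.\<close>

lemma shadowed_diffD:
  assumes "shadowed E c (tr0 @ ev # tr1) r" and "\<forall>ev \<in> set tr0. c ev = ev" and "c ev \<noteq> ev"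
  shows "\<exists>r'. E (tr0 @ [c ev]) r'"
proof -
  from assms(1,3) obtain tr0' ev' tr1' r' where
    *: "tr0 @ ev # tr1 = tr0' @ ev' # tr1'" "\<forall>ev \<in> set tr0'. c ev = ev" "c ev' \<noteq> ev'"
    "E (tr0' @ [c ev']) r'"
    unfolding shadowed_def by (metis in_set_conv_decomp)
  from assms(2,3) have "takeWhile (\<lambda>ev. c ev = ev) (tr0 @ ev # tr1) = tr0"
    by (simp add: takeWhile_tail)
  moreover from *(2,3) have "takeWhile (\<lambda>ev. c ev = ev) (tr0' @ ev' # tr1') = tr0'"
    by (simp add: takeWhile_tail)
  ultimately have "tr0 = tr0' \<and> ev = ev'" using *(1) by simp
  with *(4) show ?thesis by blast
qed

text \<open>Both renamings of \<open>s0\<close> are stacks of \<open>p\<close> with the same input,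
  so by determinacy they have the same executions. A first changed event would give one stack two
  distinct traces of equal length, contradicting \<open>exec_chain\<close>. Hence the whole trace
  carries over unchanged, while variables of the final stack may still be renamed.\<close>

lemma exec_natural_stack:
  assumes wf: "wf_program p" and inp: "vars p inp = TInt" and det: "determined_by inp p"
    and I: "I \<in> interps p"
    and s0: "\<And>x. has_type (redeclare_adt (ctors p)) (s0 x) (redeclare (vars p x))"
    and ex: "exec (def_obj p) I (body p) s0 [] tr r"
  obtains s f where "s \<in> stacks p" and "s inp = s0 inp"
    and "exec (def_obj p) I (body p) s [] tr (ren_result (ctors p) (vars p) f r)"
proof -
  let ?C = "ctors p" and ?G = "vars p" and ?A = "preds p" and ?D = "def_obj p"
  obtain k fs where D: "?D = Obj k fs" by (cases ?D)
  \<comment> \<open>The renamings have to fix all addresses that the run allocates, at most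
    \<open>length tr\<close> as the heap is initially empty, and all address fields of the default
    object. The sum is merely a convenient bound for the latter.\<close>
  define M where "M = int (length tr) + (\<Sum>a\<leftarrow>fs. \<bar>a\<bar>)"
  have sum_nonneg: "0 \<le> (\<Sum>a\<leftarrow>fs. \<bar>a\<bar>)" by (intro sum_list_nonneg) auto
  have M: "0 \<le> M" "int (length tr) \<le> M" using sum_nonneg by (auto simp: M_def)
  have fs: "a \<le> M" if "a \<in> set fs" for a
  proof -
    have "\<bar>a\<bar> \<le> (\<Sum>a\<leftarrow>fs. \<bar>a\<bar>)" using that by (intro member_le_sum_list) auto
    then show ?thesis by (simp add: M_def)
  qed
  let ?s = "\<lambda>c. ren_stack ?C ?G (ren c M) s0" and ?c = "\<lambda>c. ren_event ?C ?A ?G (ren c M)"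
  have D_fix: "ren_obj ?C (ren c M) ?D = ?D" for c
    using wf fs unfolding D by (auto simp: ren_obj_id_iff wf_program_def D has_type_TObj ren_fix
        simp del: ren_obj.simps)
  have sh: "shadowed (exec ?D I (body p) (?s c) []) (?c c) tr (ren_result ?C ?G (ren c M) r)" if "0 \<le> c" for c
    using exec_ren[OF ex, of ?C ?A ?G "ren c M"] wf ren_inj[OF M(1) that] D_fix M
    by (auto simp: wf_program_def ren_fix)
  have st: "?s c \<in> stacks p" if "0 \<le> c" for c
    using s0 ren_nonneg[OF M(1) that] by (auto simp: stacks_def ren_stack_def intro!: ren_val_has_type)
  have s_inp: "?s c inp = s0 inp" for c
    using inp by (simp add: ren_stack_def)
  have fix_iff: "?c 0 ev = ev \<longleftrightarrow> ?c 1 ev = ev" for ev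
    using M(1) by (intro ren_event_id_cong) (auto simp: ren_def)
  have eq: "executions ?D I (body p) (?s 0) [] = executions ?D I (body p) (?s 1) []"
    using det I st s_inp unfolding determined_by_def emptyHeap_def by simp
  show thesis
  proof (cases "\<forall>ev \<in> set tr. ?c 0 ev = ev")
    case True
    with shadowed_sameD[OF sh[of 0]] that[OF st[of 0]] s_inp show thesis by simp
  next
    case False
    then obtain tr0 ev tr1 where tr: "tr = tr0 @ ev # tr1" and ev: "?c 0 ev \<noteq> ev"
      and tr0: "\<forall>ev \<in> set tr0. ?c 0 ev = ev"
      using split_list_first_prop[of tr "\<lambda>ev. ?c 0 ev \<noteq> ev"] by blast
    obtain r0 where r0: "exec ?D I (body p) (?s 0) [] (tr0 @ [?c 0 ev]) r0"
      using shadowed_diffD[of _ _ tr0 ev tr1, OF _ tr0 ev] sh[of 0] tr by fastforce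
    obtain r1 where r1: "exec ?D I (body p) (?s 1) [] (tr0 @ [?c 1 ev]) r1"
      using shadowed_diffD[of _ "?c 1" tr0 ev tr1] sh[of 1] tr tr0 ev fix_iff by fastforce
    from r0 eq obtain r2 where r2: "exec ?D I (body p) (?s 1) [] (tr0 @ [?c 0 ev]) r2"
      by (auto simp: executions_def)
    \<comment> \<open>Both traces belong to the stack \<open>?s 1\<close> and have the same length,
      so being comparable they are equal.\<close>
    have "?c 0 ev = ?c 1 ev"
      using exec_chain[OF r1 r2] by auto
    from ren_event_common[OF _ this] ren_common[OF M(1)] ev show thesis by blast
  qed
qed

section \<open>The encoding simulates the program\<close>

definition reads :: "event list \<Rightarrow> (int \<times> obj) list" where
  "reads tr = concat (map (\<lambda>ev. case ev of EvRead x a v \<Rightarrow> [(a, v)] | _ \<Rightarrow> []) tr)"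

lemma reads_simps [simp]:
  "reads [] = []"
  "reads (EvAssign x v # tr) = reads tr"
  "reads (EvAlloc q a w # tr) = reads tr"
  "reads (EvRead x a w # tr) = (a, w) # reads tr"
  "reads (EvWrite q a w # tr) = reads tr"
  "reads (EvGuard v # tr) = reads tr"
  "reads (EvCheck v # tr) = reads tr"
  "reads (EvPred P vs # tr) = reads tr"
  "reads (tr @ tr') = reads tr @ reads tr'"
  by (simp_all add: reads_def)

text \<open>\<open>n\<close> is the value of \<open>cnt\<close> so far. The first element gets
  number \<open>n + 1\<close> because the encoding increments \<open>cnt\<close> before it consults
  \<open>R\<close>.\<close>

fun numbered :: "(int \<Rightarrow> 'a \<Rightarrow> bool) \<Rightarrow> int \<Rightarrow> 'a list \<Rightarrow> bool" where
  "numbered Q n [] \<longleftrightarrow> True"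
| "numbered Q n (x # xs) \<longleftrightarrow> Q (n + 1) x \<and> numbered Q (n + 1) xs"

lemma numbered_append [simp]:
  "numbered Q n (xs @ ys) \<longleftrightarrow> numbered Q n xs \<and> numbered Q (n + int (length xs)) ys"
  by (induction xs arbitrary: n) (auto simp: ac_simps)

lemma numbered_iff_nth: "numbered Q n xs \<longleftrightarrow> (\<forall>k < length xs. Q (n + 1 + int k) (xs ! k))"
  by (induction xs arbitrary: n) (auto simp: All_less_Suc2 ac_simps)

text \<open>What remains of typing when addresses may be negative: integers and objects are still
  kept apart.\<close>

fun of_kind :: "ty \<Rightarrow> val \<Rightarrow> bool" where
  "of_kind t (IntV _) \<longleftrightarrow> t \<noteq> TObj"
| "of_kind t (ObjV _) \<longleftrightarrow> t = TObj"

lemma of_kind_TObj: "of_kind TObj v \<longleftrightarrow> (\<exists>x. v = ObjV x)"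
  by (cases v) auto

lemma of_kind_TAddr: "of_kind TAddr v \<longleftrightarrow> (\<exists>n. v = IntV n)"
  by (cases v) auto

lemma has_type_of_kind: "has_type C v t \<Longrightarrow> of_kind t v"
  by (cases t) (auto simp: has_type_TObj)

lemma eval_of_kind:
  "wt_exp C G e t \<Longrightarrow> nonrecursive C \<Longrightarrow> \<forall>x. of_kind (G x) (s x) \<Longrightarrow> of_kind t (eval D e s)"
  by (induction rule: wt_exp.induct) (auto simp: nonrecursiveD)

text \<open>Covers the code of havoc, which can thus neither fail nor touch the heap, whatever
  values it computes.\<close>

fun silent :: "stmt \<Rightarrow> bool" where
  "silent (Assign x e) \<longleftrightarrow> True"
| "silent Skip \<longleftrightarrow> True"
| "silent (S1 ;; S2) \<longleftrightarrow> silent S1 \<and> silent S2"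
| "silent (If e S1 S2) \<longleftrightarrow> silent S1 \<and> silent S2"
| "silent (While e S) \<longleftrightarrow> silent S"
| "silent _ \<longleftrightarrow> False"

lemma yields_silent:
  assumes "yields D I S s h b s1 h1" and "silent S"
  shows "b = Top \<and> h1 = h"
proof -
  have "b = Top \<and> h1 = h" if "exec D I S s h tr r" "r = Fin b s1 h1" "silent S" for tr r
    using that by (induction arbitrary: b s1 h1 rule: exec.induct) fastforce+
  with assms show ?thesis by (auto simp: yields_def)
qed

lemma silent_havoc_int [simp]: "silent (havoc_int N x)"
  by (simp add: havoc_int_def Let_def)

lemma silent_havoc_list [simp]: "silent (havoc_list N xs)"
  by (induction xs) auto

lemma silent_havoc_ctors [simp]: "silent (havoc_ctors N x k C)"
  by (induction C arbitrary: k) (auto simp: Let_def)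

lemma silent_havoc_obj [simp]: "silent (havoc_obj N C x)"
  by (simp add: havoc_obj_def)

lemma assigned_havoc_int: "assigned (havoc_int N x) = {x, seed N}"
  by (auto simp: havoc_int_def Let_def)

lemma assigned_havoc_list: "assigned (havoc_list N xs) \<subseteq> insert (seed N) (set xs)"
  by (induction xs) (auto simp: assigned_havoc_int)

lemma assigned_havoc_ctors: "assigned (havoc_ctors N x k C) \<subseteq> {x, seed N} \<union> range (fld N)"
  using assigned_havoc_list[of N] by (induction C arbitrary: k) (fastforce simp: Let_def)+

lemma assigned_havoc_obj: "assigned (havoc_obj N C x) \<subseteq> {x, seed N, tag N} \<union> range (fld N)"
  using assigned_havoc_ctors[of N x 0 C] by (auto simp: havoc_obj_def assigned_havoc_int)

section \<open>The invariant between program and encoding, and its preservation by heap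
  statements\<close>

text \<open>\<open>I\<close> interprets the program and \<open>I'\<close> the encoding,
  \<open>i\<close> is the input and \<open>L\<close> the initial value of \<open>last_addr\<close>.
  Nothing relates \<open>I\<close> and \<open>I'\<close> yet, since the two directions of the
  theorem relate them differently.\<close>

locale encoding =
  fixes C :: adt and A :: "pname \<Rightarrow> ty list" and G :: "vname \<Rightarrow> ty" and D :: obj
    and R :: pname and inp :: vname and N :: aux_vars and X :: "vname set"
    and I I' :: interp and i L :: int
  assumes nonrec: "nonrecursive C"
    and fresh: "fresh_vars N X"
    and inp_X: "inp \<in> X"
    and R_typed: "[u, v, w] \<in> I' R \<Longrightarrow> \<exists>x. w = ObjV x"
begin

abbreviation enc :: "stmt \<Rightarrow> stmt" where
  "enc \<equiv> enc_stmt R inp N C"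

definition recorded :: "int \<Rightarrow> obj \<Rightarrow> bool" where
  "recorded n x \<longleftrightarrow> [IntV i, IntV n, ObjV x] \<in> I' R"

definition encodable :: "stmt \<Rightarrow> bool" where
  "encodable S \<longleftrightarrow> wt_stmt C A G S \<and> alloc_ok S \<and> vars_stmt S \<subseteq> X \<and> inp \<notin> assigned S \<and>
     R \<notin> preds_stmt S"

lemma encodable_Seq: "encodable (S1 ;; S2) \<longleftrightarrow> encodable S1 \<and> encodable S2"
  by (auto simp: encodable_def elim: wt_SeqE intro: wt_stmt.intros)

lemma encodable_IfD:
  "encodable (If e S1 S2) \<Longrightarrow> encodable S1 \<and> encodable S2 \<and> vars_exp e \<subseteq> X"
  by (auto simp: encodable_def elim: wt_IfE)

lemma encodable_WhileD:
  "encodable (While e S) \<Longrightarrow> encodable S \<and> encodable (If e (S ;; While e S) Skip) \<and> vars_exp e \<subseteq> X"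
  by (auto simp: encodable_def elim: wt_WhileE intro: wt_stmt.intros)

text \<open>The clause for \<open>last_obj\<close> is uniform in \<open>L\<close>: as long as
  \<open>L\<close> is not allocated, be it even negative, \<open>heap_read\<close> yields the
  default object, with which the encoding starts. The heap of the encoding does not occur, since
  encoded statements do not use it.\<close>

definition sim :: "stack \<Rightarrow> stack \<Rightarrow> heap \<Rightarrow> int \<Rightarrow> bool" where
  "sim s' s h n \<longleftrightarrow> (\<forall>x \<in> X. s' x = s x) \<and> (\<forall>x. of_kind (G x) (s x)) \<and> s inp = IntV i \<and>
     s' (last_addr N) = IntV L \<and> s' (cnt N) = IntV n \<and> s' (cnt_alloc N) = IntV (int (length h)) \<and>
     s' (last_obj N) = ObjV (heap_read D h L)"

lemma fresh_simps [simp]: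
  "last_addr N \<noteq> cnt N" "last_addr N \<noteq> cnt_alloc N" "last_addr N \<noteq> last_obj N"
  "last_addr N \<noteq> seed N" "last_addr N \<noteq> tag N" "last_addr N \<noteq> fld N k"
  "cnt N \<noteq> last_addr N" "cnt N \<noteq> cnt_alloc N" "cnt N \<noteq> last_obj N"
  "cnt N \<noteq> seed N" "cnt N \<noteq> tag N" "cnt N \<noteq> fld N k"
  "cnt_alloc N \<noteq> last_addr N" "cnt_alloc N \<noteq> cnt N" "cnt_alloc N \<noteq> last_obj N"
  "cnt_alloc N \<noteq> seed N" "cnt_alloc N \<noteq> tag N" "cnt_alloc N \<noteq> fld N k"
  "last_obj N \<noteq> last_addr N" "last_obj N \<noteq> cnt N" "last_obj N \<noteq> cnt_alloc N"
  "last_obj N \<noteq> seed N" "last_obj N \<noteq> tag N" "last_obj N \<noteq> fld N k"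
  "seed N \<noteq> last_addr N" "seed N \<noteq> cnt N" "seed N \<noteq> cnt_alloc N"
  "seed N \<noteq> last_obj N" "seed N \<noteq> tag N" "seed N \<noteq> fld N k"
  "tag N \<noteq> seed N" "tag N \<noteq> fld N k"
  using fresh by (auto simp: fresh_vars_def scalar_vars_def)

lemma fld_not_scalar [simp]: "fld N k \<noteq> seed N" "fld N k \<noteq> tag N"
  using fresh_simps by metis+

lemma fresh_not_in_X [simp]:
  "last_addr N \<notin> X" "cnt N \<notin> X" "cnt_alloc N \<notin> X" "last_obj N \<notin> X" "seed N \<notin> X" "tag N \<notin> X"
  "fld N k \<notin> X"
  using fresh unfolding fresh_vars_def scalar_vars_def by auto blast

lemma in_X_not_fresh:
  "x \<in> X \<Longrightarrow> x \<noteq> last_addr N" "x \<in> X \<Longrightarrow> x \<noteq> cnt N" "x \<in> X \<Longrightarrow> x \<noteq> cnt_alloc N"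
  "x \<in> X \<Longrightarrow> x \<noteq> last_obj N" "x \<in> X \<Longrightarrow> x \<noteq> seed N" "x \<in> X \<Longrightarrow> x \<noteq> tag N" "x \<in> X \<Longrightarrow> x \<noteq> fld N k"
  by auto

lemma inp_not_fresh [simp]:
  "inp \<noteq> last_addr N" "inp \<noteq> cnt N" "inp \<noteq> cnt_alloc N" "inp \<noteq> last_obj N" "inp \<noteq> seed N"
  "inp \<noteq> tag N" "inp \<noteq> fld N k"
  using in_X_not_fresh[OF inp_X] by auto

lemma sim_eval: "sim s' s h n \<Longrightarrow> vars_exp e \<subseteq> X \<Longrightarrow> eval D e s' = eval D e s"
  by (intro eval_cong) (auto simp: sim_def)

lemma sim_eval_list:
  "sim s' s h n \<Longrightarrow> (\<Union>e \<in> set es. vars_exp e) \<subseteq> X \<Longrightarrow>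
    map (\<lambda>e. eval D e s') es = map (\<lambda>e. eval D e s) es"
  by (auto intro: sim_eval)

lemma sim_assign:
  assumes "sim s' s h n" and "x \<in> X" and "x \<noteq> inp" and "of_kind (G x) v"
  shows "sim (s'(x := v)) (s(x := v)) h n"
  using assms by (auto simp: sim_def)

lemma sim_cong:
  assumes "sim s1' s h n" and "\<And>y. y \<in> X \<union> {last_addr N, cnt N, cnt_alloc N, last_obj N} \<Longrightarrow> s2' y = s1' y"
  shows "sim s2' s h n"
  using assms by (simp add: sim_def)

lemma enc_Assign:
  assumes "sim s' s h n" and "encodable (Assign x e)"
  shows "sim (s'(x := eval D e s')) (s(x := eval D e s)) h n"
  using assms sim_eval[OF assms(1), of e]
  by (auto simp: encodable_def elim!: wt_AssignE intro!: sim_assign eval_of_kind[OF _ nonrec])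
    (auto simp: sim_def)

text \<open>An equivalence, since both directions need it: that the encoded statement can make this
  step, and that it can make no other.\<close>

definition acts :: "stmt \<Rightarrow> stack \<Rightarrow> stack \<Rightarrow> bool" where
  "acts S s s1 \<longleftrightarrow> (\<forall>h b s2 h2. yields D I' S s h b s2 h2 \<longleftrightarrow> b = Top \<and> s2 = s1 \<and> h2 = h)"

lemma acts_unique: "acts S s s1 \<Longrightarrow> yields D I' S s h b s2 h2 \<Longrightarrow> b = Top \<and> s2 = s1"
  by (simp add: acts_def)

lemma acts_yields: "acts S s s1 \<Longrightarrow> yields D I' S s h Top s1 h"
  by (simp add: acts_def)

lemma enc_Alloc:
  assumes sim: "sim s' s h n" and ok: "encodable (Alloc q e)"
    and v: "v = obj_of (eval D e s)"
  obtains s1' where "acts (enc (Alloc q e)) s' s1'"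
    and "sim s1' (s(q := IntV (int (length h) + 1))) (h @ [v]) n"
    and "s1' (seed N) = s' (seed N)"
proof -
  let ?a = "int (length h) + 1"
  let ?s2 = "s'(cnt_alloc N := IntV ?a, q := IntV ?a)"
  from ok have q: "q \<in> X" "q \<noteq> inp" "G q = TAddr" and e: "wt_exp C G e TObj" "vars_exp e \<subseteq> X" "q \<notin> vars_exp e"
    by (auto simp: encodable_def elim: wt_AllocE)
  \<comment> \<open>The encoding evaluates \<open>e\<close> after the update of \<open>q\<close>;
    this is where \<open>q \<notin> vars_exp e\<close> enters.\<close>
  have ev: "eval D e ?s2 = eval D e s"
    using e sim by (intro eval_cong) (auto simp: sim_def)
  have "of_kind TObj (eval D e s)"
    using eval_of_kind[OF e(1) nonrec] sim by (simp add: sim_def)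
  then have ev: "eval D e ?s2 = ObjV v"
    using ev v by (auto simp: of_kind_TObj)
  define s1' where "s1' = (if L = ?a then ?s2(last_obj N := ObjV v) else ?s2)"
  have "heap_read D (h @ [v]) L = (if L = ?a then v else heap_read D h L)"
    by (auto simp: heap_read_def nth_append)
  then have "sim s1' (s(q := IntV ?a)) (h @ [v]) n"
    using sim q by (auto simp: sim_def s1'_def)
  moreover have "s1' (seed N) = s' (seed N)"
    using q by (auto simp: s1'_def)
  moreover have "acts (enc (Alloc q e)) s' s1'"
    unfolding acts_def
  proof (intro allI)
    fix h' b s2' h2'
    have "s' (last_addr N) = IntV L" "s' (cnt_alloc N) = IntV (int (length h))"
      "last_addr N \<noteq> q" "cnt_alloc N \<noteq> q"
      using sim q by (auto simp: sim_def)
    then show "yields D I' (enc (Alloc q e)) s' h' b s2' h2' \<longleftrightarrow> b = Top \<and> s2' = s1' \<and> h2' = h'"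
      using ev by (auto simp: s1'_def truth_def add.commute)
  qed
  ultimately show thesis using that by blast
qed

lemma enc_Write:
  assumes sim: "sim s' s h n" and ok: "encodable (Write q e)"
    and v: "v = obj_of (eval D e s)" and a: "a = int_of (s q)"
  obtains s1' where "acts (enc (Write q e)) s' s1'"
    and "sim s1' s (heap_write h a v) n"
    and "s1' (seed N) = s' (seed N)"
proof -
  from ok have q: "q \<in> X" "G q = TAddr" and e: "wt_exp C G e TObj" "vars_exp e \<subseteq> X"
    by (auto simp: encodable_def elim: wt_WriteE)
  have "of_kind TObj (eval D e s)"
    using eval_of_kind[OF e(1) nonrec] sim by (simp add: sim_def)
  then have ev: "eval D e s' = ObjV v"
    using sim_eval[OF sim e(2)] v by (auto simp: of_kind_TObj)
  \<comment> \<open>The encoding compares values by \<open>Eq\<close>, whereas the heap operations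
    apply \<open>int_of\<close>. For a variable holding an integer the two agree.\<close>
  have "of_kind TAddr (s q)"
    using sim q by (metis sim_def)
  then have s'q: "s' q = IntV a"
    using sim q a by (auto simp: sim_def of_kind_TAddr)
  define s1' where "s1' = (if L = a \<and> 0 < a \<and> a \<le> int (length h) then s'(last_obj N := ObjV v) else s')"
  have "heap_read D (heap_write h a v) L =
      (if L = a \<and> 0 < a \<and> a \<le> int (length h) then v else heap_read D h L)"
    by (auto simp: heap_read_def heap_write_def nth_list_update)
  moreover have "length (heap_write h a v) = length h"
    by (simp add: heap_write_def)
  ultimately have "sim s1' s (heap_write h a v) n"
    using sim by (auto simp: sim_def s1'_def)
  moreover have "s1' (seed N) = s' (seed N)"
    by (auto simp: s1'_def)
  moreover have "acts (enc (Write q e)) s' s1'"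
    unfolding acts_def
  proof (intro allI)
    fix h' b s2' h2'
    have "s' (last_addr N) = IntV L" "s' (cnt_alloc N) = IntV (int (length h))"
      using sim by (auto simp: sim_def)
    then show "yields D I' (enc (Write q e)) s' h' b s2' h2' \<longleftrightarrow> b = Top \<and> s2' = s1' \<and> h2' = h'"
      using ev s'q by (auto simp: s1'_def truth_def)
  qed
  ultimately show thesis using that by blast
qed

lemma enc_Read_last:
  assumes sim: "sim s' s h n" and ok: "encodable (Read x q)"
    and a: "a = int_of (s q)" and v: "v = heap_read D h a" and L: "L = a"
  obtains s1' where "recorded (n + 1) v \<Longrightarrow> acts (enc (Read x q)) s' s1'"
    and "\<And>h'. \<not> recorded (n + 1) v \<Longrightarrow> yields D I' (enc (Read x q)) s' h'
      (Bot (Pred R) [IntV i, IntV (n + 1), ObjV v]) (s'(cnt N := IntV (n + 1))) h'"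
    and "sim s1' (s(x := ObjV v)) h (n + 1)"
    and "s1' (seed N) = s' (seed N)"
proof -
  from ok have x: "x \<in> X" "G x = TObj" "x \<noteq> inp" and q: "q \<in> X" "G q = TAddr"
    by (auto simp: encodable_def elim: wt_ReadE)
  have "of_kind TAddr (s q)"
    using sim q by (metis sim_def)
  then have s'q: "s' q = IntV a"
    using sim q a by (auto simp: sim_def of_kind_TAddr)
  define s1' where "s1' = s'(cnt N := IntV (n + 1), x := ObjV v)"
  have *: "s' (last_addr N) = IntV L" "s' (cnt N) = IntV n" "s' (last_obj N) = ObjV v" "s' inp = IntV i"
    "q \<noteq> cnt N" "x \<noteq> cnt N"
    using sim inp_X q x unfolding sim_def v L[symmetric] by auto
  have "sim s1' (s(x := ObjV v)) h (n + 1)"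
    using sim x by (auto simp: sim_def s1'_def)
  moreover have "s1' (seed N) = s' (seed N)"
    using x by (auto simp: s1'_def)
  moreover have "acts (enc (Read x q)) s' s1'" if "recorded (n + 1) v"
    using * s'q L that by (auto simp: s1'_def truth_def recorded_def acts_def)
  moreover have "yields D I' (enc (Read x q)) s' h'
      (Bot (Pred R) [IntV i, IntV (n + 1), ObjV v]) (s'(cnt N := IntV (n + 1))) h'"
    if "\<not> recorded (n + 1) v" for h'
    using * s'q L that by (auto simp: truth_def recorded_def)
  ultimately show thesis using that by blast
qed

text \<open>A havoc filtered by \<open>R\<close>. From left to right, the first part shows that a
  guess that passes is recorded; from right to left, that a recorded guess passes. The invariant is
  restored exactly for the guess that the program would read.\<close>

lemma enc_Read_other:
  assumes sim: "sim s' s h n" and ok: "encodable (Read x q)"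
    and a: "a = int_of (s q)" and v: "v = heap_read D h a" and L: "L \<noteq> a"
  shows "yields D I' (enc (Read x q)) s' h' b s2' h2' \<longleftrightarrow>
      yields D I' (havoc_obj N C x) (s'(cnt N := IntV (n + 1))) h' Top s2' h2' \<and> b = Top \<and>
      (\<exists>w. s2' x = ObjV w \<and> recorded (n + 1) w)"
    and "yields D I' (havoc_obj N C x) (s'(cnt N := IntV (n + 1))) h' Top s2' h2' \<Longrightarrow>
      s2' x = ObjV v \<Longrightarrow> sim s2' (s(x := ObjV v)) h (n + 1)"
proof -
  from ok have x: "x \<in> X" "G x = TObj" "x \<noteq> inp" and q: "q \<in> X" "G q = TAddr"
    by (auto simp: encodable_def elim: wt_ReadE)
  have "of_kind TAddr (s q)"
    using sim q by (metis sim_def)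
  then have s'q: "s' q = IntV a"
    using sim q a by (auto simp: sim_def of_kind_TAddr)
  have *: "s' (last_addr N) = IntV L" "s' (cnt N) = IntV n" "s' inp = IntV i"
    "q \<noteq> cnt N" "x \<noteq> cnt N"
    using sim inp_X q x by (auto simp: sim_def)
  have hv: "b = Top \<and> h2' = h' \<and> (\<forall>y. y \<notin> {x, seed N, tag N} \<union> range (fld N) \<longrightarrow> s2' y = (s'(cnt N := IntV (n + 1))) y)"
    if "yields D I' (havoc_obj N C x) (s'(cnt N := IntV (n + 1))) h' b s2' h2'" for h' b s2' h2'
  proof (intro conjI allI impI)
    show "s2' y = (s'(cnt N := IntV (n + 1))) y" if "y \<notin> {x, seed N, tag N} \<union> range (fld N)" for y
      using assigned_havoc_obj[of N C x] that
      by (intro yields_unassigned[OF \<open>yields _ _ _ _ _ _ _ _\<close>]) blast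
  qed (use yields_silent[OF that] in auto)
  show "sim s2' (s(x := ObjV v)) h (n + 1)"
    if "yields D I' (havoc_obj N C x) (s'(cnt N := IntV (n + 1))) h' Top s2' h2'" "s2' x = ObjV v"
  proof (rule sim_cong)
    show "sim (s'(cnt N := IntV (n + 1), x := ObjV v)) (s(x := ObjV v)) h (n + 1)"
      using sim x by (auto simp: sim_def)
    show "s2' y = (s'(cnt N := IntV (n + 1), x := ObjV v)) y"
      if "y \<in> X \<union> {last_addr N, cnt N, cnt_alloc N, last_obj N}" for y
      using hv[OF \<open>yields _ _ _ _ _ _ _ _\<close>] that x \<open>s2' x = _\<close> by auto
  qed
  have "s2' (cnt N) = IntV (n + 1) \<and> s2' inp = IntV i"
    if "yields D I' (havoc_obj N C x) (s'(cnt N := IntV (n + 1))) h' b s2' h2'" for h' b s2' h2'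
    using hv[OF that] * x by auto
  then show "yields D I' (enc (Read x q)) s' h' b s2' h2' \<longleftrightarrow>
      yields D I' (havoc_obj N C x) (s'(cnt N := IntV (n + 1))) h' Top s2' h2' \<and> b = Top \<and>
      (\<exists>w. s2' x = ObjV w \<and> recorded (n + 1) w)"
    using * s'q L hv R_typed by (auto simp: truth_def recorded_def) metis+
qed

end

section \<open>Soundness of the encoding when \<open>R\<close> is exact\<close>

context encoding
begin

text \<open>Quantifying over all traces, cut ones included, makes the property available at a read
  before it is known how the run goes on, and lets it pass to substatements along prefixes.\<close>

definition determinate :: "int \<Rightarrow> stmt \<Rightarrow> stack \<Rightarrow> heap \<Rightarrow> bool" where
  "determinate n S s h \<longleftrightarrow> (\<forall>tr r. exec D I S s h tr r \<longrightarrow>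
     numbered (\<lambda>k (a, v). \<forall>w. recorded k w \<longleftrightarrow> w = v) n (reads tr))"

lemma determinate_prefix:
  assumes "determinate n S s h" and "\<And>tr r. exec D I S' s' h' tr r \<Longrightarrow> \<exists>r'. exec D I S s h (tr0 @ tr) r'"
  shows "determinate (n + int (length (reads tr0))) S' s' h'"
  unfolding determinate_def
proof (intro allI impI)
  fix tr r
  assume "exec D I S' s' h' tr r"
  with assms(2) obtain r' where "exec D I S s h (tr0 @ tr) r'" by blast
  with assms(1) have "numbered (\<lambda>k (a, v). \<forall>w. recorded k w \<longleftrightarrow> w = v) n (reads (tr0 @ tr))"
    unfolding determinate_def by blast
  then show "numbered (\<lambda>k (a, v). \<forall>w. recorded k w \<longleftrightarrow> w = v) (n + int (length (reads tr0))) (reads tr)"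
    by simp
qed

lemma determinate_Seq1:
  assumes "determinate n (S1 ;; S2) s h"
  shows "determinate n S1 s h"
proof -
  have "determinate (n + int (length (reads []))) S1 s h"
    by (rule determinate_prefix[OF assms]) (use exec_SeqI_first in auto)
  then show ?thesis by simp
qed

lemma determinate_Seq2:
  assumes "determinate n (S1 ;; S2) s h" and "exec D I S1 s h tr1 (Fin Top s1 h1)"
  shows "determinate (n + int (length (reads tr1))) S2 s1 h1"
  by (rule determinate_prefix[OF assms(1)]) (use exec.seq[OF assms(2)] in blast)

lemma determinate_If:
  assumes "determinate n (If e S1 S2) s h"
  shows "determinate n (if eval D e s = IntV 0 then S2 else S1) s h"
proof -
  have "determinate (n + int (length (reads [EvGuard (eval D e s)])))
      (if eval D e s = IntV 0 then S2 else S1) s h"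
  proof (rule determinate_prefix[OF assms])
    show "\<exists>r'. exec D I (If e S1 S2) s h ([EvGuard (eval D e s)] @ tr) r'"
      if "exec D I (if eval D e s = IntV 0 then S2 else S1) s h tr r" for tr r
      using that exec.if_true[OF refl, of D e s I S1 h tr r S2] exec.if_false[OF refl, of D e s I S2 h tr r S1]
      by (cases "eval D e s = IntV 0") auto
  qed
  then show ?thesis by simp
qed

lemma determinate_While:
  assumes "determinate n (While e S) s h"
  shows "determinate n (If e (S ;; While e S) Skip) s h"
  using assms exec.while unfolding determinate_def by blast

lemma simulatedI:
  "exec D I S s h tr (Fin b s1 h1) \<Longrightarrow> sim s1' s1 h1 (n + int (length (reads tr))) \<Longrightarrow>
    \<exists>tr s1 h1. exec D I S s h tr (Fin b s1 h1) \<and> sim s1' s1 h1 (n + int (length (reads tr)))"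
  by blast

text \<open>Induction on the source statement, because the derivation for the encoding passes
  through generated code. Only reads could depart from the program: at \<open>L\<close> the
  assertion succeeds as the object is recorded, elsewhere the assume leaves no other object.\<close>

lemma enc_sound:
  assumes I': "\<And>P. P \<noteq> R \<Longrightarrow> I' P = I P"
    and "encodable S" and "yields D I' (enc S) s' h' b s1' h1'" and "sim s' s h n"
    and "determinate n S s h"
  shows "\<exists>tr s1 h1. exec D I S s h tr (Fin b s1 h1) \<and> sim s1' s1 h1 (n + int (length (reads tr)))"
  using assms(2-)
proof (induction S arbitrary: s' h' b s1' h1' s h n)
  case (Assign x e)
  have "vars_exp e \<subseteq> X" using Assign.prems(1) by (auto simp: encodable_def)
  then have res: "b = Top" "s1' = s'(x := eval D e s)"
    using Assign.prems(2) sim_eval[OF Assign.prems(3), of e] by simp_all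
  have ex: "exec D I (Assign x e) s h [EvAssign x (eval D e s)] (Fin Top (s(x := eval D e s)) h)"
    by (rule exec.assign) simp
  have "sim s1' (s(x := eval D e s)) h n"
    using enc_Assign[OF Assign.prems(3,1)]
    unfolding sim_eval[OF Assign.prems(3) \<open>vars_exp e \<subseteq> X\<close>] res(2) .
  with res(1) show ?case using simulatedI[OF ex] by simp
next
  case (Alloc q e)
  obtain s2' where s2': "acts (enc (Alloc q e)) s' s2'"
    "sim s2' (s(q := IntV (int (length h) + 1))) (h @ [obj_of (eval D e s)]) n"
    using enc_Alloc[OF Alloc.prems(3,1) refl] by blast
  have ex: "exec D I (Alloc q e) s h [EvAlloc q (int (length h) + 1) (obj_of (eval D e s))]
      (Fin Top (s(q := IntV (int (length h) + 1))) (h @ [obj_of (eval D e s)]))"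
    by (rule exec.alloc) (auto simp: allocate_def)
  from acts_unique[OF s2'(1) Alloc.prems(2)] s2'(2) show ?case using simulatedI[OF ex] by simp
next
  case (Read x q)
  let ?a = "int_of (s q)" let ?v = "heap_read D h ?a"
  have ex: "exec D I (Read x q) s h [EvRead x ?a ?v] (Fin Top (s(x := ObjV ?v)) h)"
    by (rule exec.load) auto
  \<comment> \<open>The trace consisting of this read alone already tells what \<open>R\<close>
    contains for number \<open>n + 1\<close>.\<close>
  with Read.prems(4) have rec: "recorded (n + 1) w \<longleftrightarrow> w = ?v" for w
    unfolding determinate_def by fastforce
  show ?case
  proof (cases "L = ?a")
    case True
    obtain s2' where s2': "recorded (n + 1) ?v \<Longrightarrow> acts (enc (Read x q)) s' s2'"
      "sim s2' (s(x := ObjV ?v)) h (n + 1)"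
      using enc_Read_last[OF Read.prems(3,1) refl refl True] by metis
    have "b = Top \<and> s1' = s2'"
      using acts_unique[OF s2'(1) Read.prems(2)] rec by simp
    with s2'(2) show ?thesis using simulatedI[OF ex] by simp
  next
    case False
    note other = enc_Read_other[OF Read.prems(3,1) refl refl False]
    have "b = Top" "s1' x = ObjV ?v"
      using iffD1[OF other(1) Read.prems(2)] rec by auto
    moreover have "sim s1' (s(x := ObjV ?v)) h (n + 1)"
      using iffD1[OF other(1) Read.prems(2)] other(2) \<open>s1' x = _\<close> by blast
    ultimately have "b = Top" "sim s1' (s(x := ObjV ?v)) h (n + 1)" by blast+
    then show ?thesis using simulatedI[OF ex] by simp
  qed
next
  case (Write q e)
  obtain s2' where s2': "acts (enc (Write q e)) s' s2'"
    "sim s2' s (heap_write h (int_of (s q)) (obj_of (eval D e s))) n"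
    using enc_Write[OF Write.prems(3,1) refl refl] by blast
  have ex: "exec D I (Write q e) s h [EvWrite q (int_of (s q)) (obj_of (eval D e s))]
      (Fin Top s (heap_write h (int_of (s q)) (obj_of (eval D e s))))"
    by (rule exec.store) auto
  from acts_unique[OF s2'(1) Write.prems(2)] s2'(2) show ?case using simulatedI[OF ex] by simp
next
  case Skip
  then show ?case using simulatedI[OF exec.skip] by simp
next
  case (Seq S1 S2)
  have ok: "encodable S1" "encodable S2" using Seq.prems(1) by (simp_all add: encodable_Seq)
  note det1 = determinate_Seq1[OF Seq.prems(4)]
  from Seq.prems(2) consider
    (ok) s2' h2' where "yields D I' (enc S1) s' h' Top s2' h2'" "yields D I' (enc S2) s2' h2' b s1' h1'"
    | (fail) "b \<noteq> Top" "yields D I' (enc S1) s' h' b s1' h1'"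
    unfolding enc_stmt.simps yields_Seq by blast
  then show ?case
  proof cases
    case ok
    from Seq.IH(1)[OF \<open>encodable S1\<close> ok(1) Seq.prems(3) det1] obtain tr1 s2 h2 where
      1: "exec D I S1 s h tr1 (Fin Top s2 h2)" "sim s2' s2 h2 (n + int (length (reads tr1)))" by blast
    from Seq.IH(2)[OF \<open>encodable S2\<close> ok(2) 1(2) determinate_Seq2[OF Seq.prems(4) 1(1)]] obtain tr2 s3 h3 where
      "exec D I S2 s2 h2 tr2 (Fin b s3 h3)"
      "sim s1' s3 h3 (n + int (length (reads tr1)) + int (length (reads tr2)))" by blast
    with exec.seq[OF 1(1)] show ?thesis
      by (intro exI[of _ "tr1 @ tr2"] exI[of _ s3] exI[of _ h3]) (auto simp: ac_simps)
  next
    case fail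
    from Seq.IH(1)[OF ok(1) fail(2) Seq.prems(3) det1] obtain tr s2 h2 where
      1: "exec D I S1 s h tr (Fin b s2 h2)" "sim s1' s2 h2 (n + int (length (reads tr)))" by blast
    have "exec D I (S1 ;; S2) s h tr (Fin b s2 h2)"
      by (rule exec.seq_abort[OF 1(1)]) (use fail(1) in simp)
    from simulatedI[OF this 1(2)] show ?thesis .
  qed
next
  case (If e S1 S2)
  have ok: "encodable S1" "encodable S2" "vars_exp e \<subseteq> X"
    using encodable_IfD[OF If.prems(1)] by blast+
  note ev = sim_eval[OF If.prems(3) ok(3)]
  let ?v = "eval D e s"
  show ?case
  proof (cases "?v = IntV 0")
    case True
    have step: "exec D I (If e S1 S2) s h (EvGuard ?v # tr) r" if "exec D I S2 s h tr r" for tr r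
      using that True by (intro exec.if_false) auto
    have "yields D I' (enc S2) s' h' b s1' h1'"
      using If.prems(2) ev True by simp
    moreover have "determinate n S2 s h"
      using determinate_If[OF If.prems(4)] True by simp
    ultimately obtain tr s1 h1 where
      "exec D I S2 s h tr (Fin b s1 h1)" "sim s1' s1 h1 (n + int (length (reads tr)))"
      using If.IH(2)[OF ok(2) _ If.prems(3)] by blast
    with step show ?thesis
      by (intro exI[of _ "EvGuard ?v # tr"] exI[of _ s1] exI[of _ h1]) simp
  next
    case False
    have step: "exec D I (If e S1 S2) s h (EvGuard ?v # tr) r" if "exec D I S1 s h tr r" for tr r
      using that False by (intro exec.if_true) auto
    have "yields D I' (enc S1) s' h' b s1' h1'"
      using If.prems(2) ev False by simp
    moreover have "determinate n S1 s h"
      using determinate_If[OF If.prems(4)] False by simp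
    ultimately obtain tr s1 h1 where
      "exec D I S1 s h tr (Fin b s1 h1)" "sim s1' s1 h1 (n + int (length (reads tr)))"
      using If.IH(1)[OF ok(1) _ If.prems(3)] by blast
    with step show ?thesis
      by (intro exI[of _ "EvGuard ?v # tr"] exI[of _ s1] exI[of _ h1]) simp
  qed
next
  case (While e S)
  have ok: "encodable S" "vars_exp e \<subseteq> X"
    using encodable_WhileD[OF While.prems(1)] by blast+
  have unfold: "exec D I (While e S) s h (EvGuard (eval D e s) # tr) r"
    if "exec D I (S ;; While e S) s h tr r" "eval D e s \<noteq> IntV 0" for s h tr r
    using that by (intro exec.while exec.if_true) auto
  from While.prems(2) have "yields D I' (While e (enc S)) s' h' b s1' h1'" by simp
  then show ?case using While.prems(3,4)
  proof (induction arbitrary: s h n rule: yields_While_induct)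
    case (exit s' h')
    have ex: "exec D I (While e S) s h [EvGuard (eval D e s)] (Fin Top s h)"
      using exit sim_eval[OF exit(2) ok(2)] by (intro exec.while exec.if_false exec.skip) auto
    from exit(2) show ?case using simulatedI[OF ex] by simp
  next
    case (abort s' h' b s1' h1')
    have ev: "eval D e s \<noteq> IntV 0" using abort sim_eval[OF abort(4) ok(2)] by simp
    have "determinate n S s h"
      using determinate_If[OF determinate_While[OF abort(5)]] ev by (simp add: determinate_Seq1)
    from While.IH[OF ok(1) abort(2,4) this] obtain tr s1 h1 where
      "exec D I S s h tr (Fin b s1 h1)" "sim s1' s1 h1 (n + int (length (reads tr)))" by blast
    with unfold[OF exec.seq_abort ev] abort(3) show ?case
      by (intro exI[of _ "EvGuard (eval D e s) # tr"] exI[of _ s1] exI[of _ h1]) auto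
  next
    case (step s' h' s2' h2' b s1' h1')
    have ev: "eval D e s \<noteq> IntV 0" using step sim_eval[OF step(4) ok(2)] by simp
    have "determinate n S s h"
      using determinate_If[OF determinate_While[OF step(5)]] ev by (simp add: determinate_Seq1)
    from While.IH[OF ok(1) step(2,4) this] obtain tr1 s2 h2 where
      1: "exec D I S s h tr1 (Fin Top s2 h2)" "sim s2' s2 h2 (n + int (length (reads tr1)))" by blast
    have "determinate (n + int (length (reads tr1))) (While e S) s2 h2"
      using determinate_If[OF determinate_While[OF step(5)]] ev determinate_Seq2[OF _ 1(1)] by simp
    from step.IH[OF 1(2) this] obtain tr2 s3 h3 where
      "exec D I (While e S) s2 h2 tr2 (Fin b s3 h3)"
      "sim s1' s3 h3 (n + int (length (reads tr1)) + int (length (reads tr2)))" by blast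
    with unfold[OF exec.seq[OF 1(1)] ev] show ?case
      by (intro exI[of _ "EvGuard (eval D e s) # tr1 @ tr2"] exI[of _ s3] exI[of _ h3]) (auto simp: ac_simps)
  qed
next
  case (Assume e)
  have "vars_exp e \<subseteq> X" using Assume.prems(1) by (auto simp: encodable_def)
  with Assume.prems(2,3) have "eval D e s \<noteq> IntV 0 \<and> b = Top \<and> s1' = s'"
    by (simp add: sim_eval)
  then show ?case using simulatedI[OF exec.assume_ok[OF refl]] Assume.prems(3) by simp
next
  case (Assert e)
  have "vars_exp e \<subseteq> X" using Assert.prems(1) by (auto simp: encodable_def)
  with Assert.prems(2,3)
  have "b = (if eval D e s \<noteq> IntV 0 then Top else Bot FSym []) \<and> s1' = s'"
    by (simp add: sim_eval)
  then show ?case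
    using simulatedI[OF exec.assert_ok[OF refl]] simulatedI[OF exec.assert_fail[OF refl]] Assert.prems(3)
    by (cases "eval D e s = IntV 0") simp_all
next
  case (AssumeP P es)
  have "(\<Union>e \<in> set es. vars_exp e) \<subseteq> X" "P \<noteq> R" using AssumeP.prems(1) by (auto simp: encodable_def)
  with AssumeP.prems(2) sim_eval_list[OF AssumeP.prems(3), of es] I'[of P]
  have "map (\<lambda>e. eval D e s) es \<in> I P \<and> b = Top \<and> s1' = s'" by simp
  then show ?case using simulatedI[OF exec.assumeP_ok[OF refl]] AssumeP.prems(3) by simp
next
  case (AssertP P es)
  let ?vs = "map (\<lambda>e. eval D e s) es"
  have "(\<Union>e \<in> set es. vars_exp e) \<subseteq> X" "P \<noteq> R" using AssertP.prems(1) by (auto simp: encodable_def)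
  with AssertP.prems(2) sim_eval_list[OF AssertP.prems(3), of es] I'[of P]
  have "b = (if ?vs \<in> I P then Top else Bot (Pred P) ?vs) \<and> s1' = s'" by simp
  then show ?case
    using simulatedI[OF exec.assertP_ok[OF refl]] simulatedI[OF exec.assertP_fail[OF refl]] AssertP.prems(3)
    by (cases "?vs \<in> I P") simp_all
qed

end

section \<open>Havoc reaches every integer and every object\<close>

text \<open>Halving with rounding down shrinks the absolute value until 0 or -1 is reached. These
  are the two values to which havoc can initialise its variable.\<close>

lemma int_halving:
  assumes "Q v" and half: "\<And>v::int. Q v \<Longrightarrow> Q (v div 2)"
  shows "Q 0 \<or> Q (- 1)"
  using assms(1)
proof (induction "nat \<bar>v\<bar>" arbitrary: v rule: less_induct)
  case less
  show ?case
  proof (cases "v = 0 \<or> v = - 1")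
    case False
    then have "nat \<bar>v div 2\<bar> < nat \<bar>v\<bar>" by linarith
    with less half show ?thesis by blast
  qed (use less in auto)
qed

lemma yields_SeqI:
  "yields D I S1 s h Top s2 h2 \<Longrightarrow> yields D I S2 s2 h2 b s1 h1 \<Longrightarrow> yields D I (S1 ;; S2) s h b s1 h1"
  by auto

lemma yields_WhileI:
  assumes "eval D e s \<noteq> IntV 0" and "yields D I S s h Top s2 h2" and "yields D I (While e S) s2 h2 b s1 h1"
  shows "yields D I (While e S) s h b s1 h1"
proof -
  have "yields D I (S ;; While e S) s h b s1 h1" by (rule yields_SeqI[OF assms(2,3)])
  with assms(1) show ?thesis by (subst yields_While, subst yields_If) simp
qed

text \<open>Reading the two's complement representation of the target value backwards, with a control bit
  in front of each digit, yields the seed.\<close>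

lemma yields_havoc_int:
  assumes x: "x \<noteq> seed N"
  obtains sd where "\<And>s h. s (seed N) = IntV sd \<Longrightarrow>
    yields D I (havoc_int N x) s h Top (s(x := IntV v, seed N := IntV sd')) h"
proof -
  let ?bit = "Bin Modulo (Var (seed N)) (Num 2)"
  let ?shift = "Assign (seed N) (Bin Divide (Var (seed N)) (Num 2))"
  let ?B = "?shift ;; Assign x (Bin Plus (Bin Times (Num 2) (Var x)) ?bit) ;; ?shift"
  let ?W = "While (Eq ?bit (Num 1)) ?B"
  define loop where "loop y w \<longleftrightarrow> (\<forall>s h. s x = IntV y \<longrightarrow> s (seed N) = IntV w \<longrightarrow>
    yields D I ?W s h Top (s(x := IntV v, seed N := IntV (2 * sd'))) h)" for y w
  \<comment> \<open>An even seed has control bit 0 and ends the loop; the last shift then drops this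
    bit and leaves \<open>sd'\<close>.\<close>
  have base: "loop v (2 * sd')"
    unfolding loop_def by (subst yields_While) (auto simp: truth_def fun_upd_idem)
  \<comment> \<open>One iteration backwards takes the last binary digit off \<open>y\<close> and
    puts it, below it the control bit 1, at the low end of the seed.\<close>
  have step: "loop (y div 2) (1 + 2 * (y mod 2 + 2 * w))" if "loop y w" for y w
    unfolding loop_def
  proof (intro allI impI)
    fix s :: stack and h
    assume s: "s x = IntV (y div 2)" "s (seed N) = IntV (1 + 2 * (y mod 2 + 2 * w))"
    let ?s = "s(x := IntV y, seed N := IntV w)"
    have y: "2 * (y div 2) + y mod 2 = y" by simp
    have d: "(1 + 2 * (y mod 2 + 2 * w)) div 2 = y mod 2 + 2 * w"
      "(y mod 2 + 2 * w) mod 2 = y mod 2" "(y mod 2 + 2 * w) div 2 = w"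
      "(1 + 2 * (y mod 2 + 2 * w)) mod 2 = 1" by presburger+
    let ?s1 = "s(seed N := IntV (y mod 2 + 2 * w))"
    have 1: "yields D I ?shift s h Top ?s1 h"
      using s d by simp
    have 2: "yields D I (Assign x (Bin Plus (Bin Times (Num 2) (Var x)) ?bit)) ?s1 h Top
        (?s1(x := IntV y)) h"
      using s d x y by simp
    have 3: "yields D I ?shift (?s1(x := IntV y)) h Top ?s h"
      using d x by (simp add: fun_upd_twist)
    have 4: "yields D I ?W ?s h Top (?s(x := IntV v, seed N := IntV (2 * sd'))) h"
      using that[unfolded loop_def, rule_format, of ?s h] x by simp
    have 5: "?s(x := IntV v, seed N := IntV (2 * sd')) = s(x := IntV v, seed N := IntV (2 * sd'))"
      by (auto simp: fun_eq_iff)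
    have 6: "eval D (Eq ?bit (Num 1)) s \<noteq> IntV 0"
      using s d by (simp add: truth_def)
    show "yields D I ?W s h Top (s(x := IntV v, seed N := IntV (2 * sd'))) h"
      using yields_WhileI[OF 6 yields_SeqI[OF 1 yields_SeqI[OF 2 3]] 4] unfolding 5 .
  qed
  have "\<exists>w. loop 0 w \<or> loop (- 1) w"
    using int_halving[of "\<lambda>y. \<exists>w. loop y w" v] base step by blast
  then obtain w c where w: "loop (- c) w" "c = 0 \<or> c = 1" by force
  \<comment> \<open>\<open>c\<close> is the sign digit: the first assignment sets the variable to
    \<open>- c\<close>.\<close>
  show thesis
  proof (rule that[of "c + 2 * w"])
    fix s :: stack and h
    assume s: "s (seed N) = IntV (c + 2 * w)"
    have c: "(c + 2 * w) mod 2 = c" "(c + 2 * w) div 2 = w" using w(2) by auto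
    let ?s = "s(x := IntV (- c), seed N := IntV w)"
    have 1: "yields D I (Assign x (UMinus ?bit)) s h Top (s(x := IntV (- c))) h"
      using s c by simp
    have 2: "yields D I ?shift (s(x := IntV (- c))) h Top ?s h"
      using s c x by simp
    have 3: "yields D I ?W ?s h Top (?s(x := IntV v, seed N := IntV (2 * sd'))) h"
      using w(1)[unfolded loop_def, rule_format, of ?s h] x by simp
    have 4: "yields D I ?shift (?s(x := IntV v, seed N := IntV (2 * sd'))) h Top
        (?s(x := IntV v, seed N := IntV (2 * sd'), seed N := IntV sd')) h"
      by simp
    have 5: "?s(x := IntV v, seed N := IntV (2 * sd'), seed N := IntV sd') = s(x := IntV v, seed N := IntV sd')"
      by (auto simp: fun_eq_iff)
    show "yields D I (havoc_int N x) s h Top (s(x := IntV v, seed N := IntV sd')) h"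
      using yields_SeqI[OF 1 yields_SeqI[OF 2 yields_SeqI[OF 3 4]]]
      unfolding 5 havoc_int_def Let_def .
  qed
qed

text \<open>The seed is built from the last variable to the first. Distinctness protects a value
  once obtained from the later havocs.\<close>

lemma yields_havoc_list:
  assumes "distinct xs" and "seed N \<notin> set xs" and "length vs = length xs"
  shows "\<exists>sd. \<forall>s h. s (seed N) = IntV sd \<longrightarrow> (\<exists>s1. yields D I (havoc_list N xs) s h Top s1 h \<and>
    map s1 xs = map IntV vs \<and> s1 (seed N) = IntV sd')"
  using assms
proof (induction xs arbitrary: vs)
  case Nil
  then show ?case by (intro exI[of _ sd']) simp
next
  case (Cons x xs)
  then obtain v vs' where vs: "vs = v # vs'" "length vs' = length xs" by (cases vs) auto
  from Cons.IH[OF _ _ vs(2)] Cons.prems(1,2) obtain sd1 where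
    1: "\<And>s h. s (seed N) = IntV sd1 \<Longrightarrow> \<exists>s1. yields D I (havoc_list N xs) s h Top s1 h \<and>
      map s1 xs = map IntV vs' \<and> s1 (seed N) = IntV sd'" by auto
  have x: "x \<noteq> seed N" using Cons.prems(2) by auto
  obtain sd where 2: "\<And>s h. s (seed N) = IntV sd \<Longrightarrow>
    yields D I (havoc_int N x) s h Top (s(x := IntV v, seed N := IntV sd1)) h"
    using yields_havoc_int[OF x] by metis
  show ?case
  proof (intro exI[of _ sd] allI impI)
    fix s :: stack and h
    assume "s (seed N) = IntV sd"
    let ?s = "s(x := IntV v, seed N := IntV sd1)"
    from 1[of ?s h] obtain s1 where s1: "yields D I (havoc_list N xs) ?s h Top s1 h"
      "map s1 xs = map IntV vs'" "s1 (seed N) = IntV sd'" by auto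
    have "x \<notin> assigned (havoc_list N xs)"
      using assigned_havoc_list[of N xs] x Cons.prems(1) by auto
    then have "s1 x = IntV v"
      using yields_unassigned[OF s1(1)] x by simp
    moreover have "yields D I (havoc_list N (x # xs)) s h Top s1 h"
      using 2[of s h, OF \<open>s (seed N) = IntV sd\<close>] s1(1) by auto
    ultimately show "\<exists>s1. yields D I (havoc_list N (x # xs)) s h Top s1 h \<and>
        map s1 (x # xs) = map IntV vs \<and> s1 (seed N) = IntV sd'"
      using s1 vs by auto
  qed
qed

text \<open>\<open>j\<close> counts the constructors already passed, so that position
  \<open>k\<close> of the remaining list has index \<open>j + k\<close>.\<close>

lemma yields_havoc_ctors:
  assumes "yields D I (havoc_list N (map (fld N) [0..<length (C ! k)]) ;;
      Assign x (Ctor (j + k) (map Var (map (fld N) [0..<length (C ! k)])))) s h b s1 h1"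
    and "k < length C" and "s (tag N) = IntV (int (j + k))"
  shows "yields D I (havoc_ctors N x j C) s h b s1 h1"
  using assms
proof (induction C arbitrary: j k)
  case (Cons ts C)
  then show ?case
    by (cases k) (auto simp: Let_def truth_def simp del: upt_Suc)
qed simp

context encoding
begin

text \<open>The seed for the fields is found first, being what the havoc of the constructor index
  has to leave over.\<close>

lemma yields_havoc_obj:
  assumes x: "x \<in> X" and o: "has_type C (ObjV v) TObj"
  obtains sd where "\<And>s h. s (seed N) = IntV sd \<Longrightarrow>
    \<exists>s1. yields D I' (havoc_obj N C x) s h Top s1 h \<and> s1 x = ObjV v \<and> s1 (seed N) = IntV sd'"
proof -
  from o obtain k fs where v: "v = Obj k fs" "k < length C" "length fs = length (C ! k)"
    by (auto simp: has_type_TObj)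
  let ?xs = "map (fld N) [0..<length (C ! k)]"
  have "inj (fld N)" using fresh by (simp add: fresh_vars_def)
  then have "distinct ?xs" by (auto simp: distinct_map intro: inj_on_subset)
  moreover have "seed N \<notin> set ?xs" by auto
  moreover have "length fs = length ?xs" using v(3) by simp
  ultimately obtain sd1 where
    1: "\<forall>s h. s (seed N) = IntV sd1 \<longrightarrow> (\<exists>s1. yields D I' (havoc_list N ?xs) s h Top s1 h \<and>
      map s1 ?xs = map IntV fs \<and> s1 (seed N) = IntV sd')"
    using yields_havoc_list by blast
  have "tag N \<noteq> seed N" by simp
  then obtain sd where 2: "\<And>s h. s (seed N) = IntV sd \<Longrightarrow>
    yields D I' (havoc_int N (tag N)) s h Top (s(tag N := IntV (int k), seed N := IntV sd1)) h"
    using yields_havoc_int by metis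
  show thesis
  proof (rule that[of sd])
    fix s :: stack and h
    assume s: "s (seed N) = IntV sd"
    let ?s = "s(tag N := IntV (int k), seed N := IntV sd1)"
    have "?s (seed N) = IntV sd1" by simp
    with 1 obtain s1 where s1: "yields D I' (havoc_list N ?xs) ?s h Top s1 h"
      "map s1 ?xs = map IntV fs" "s1 (seed N) = IntV sd'" by blast
    have "map (\<lambda>e. int_of (eval D e s1)) (map Var ?xs) = map int_of (map s1 ?xs)"
      by simp
    also have "\<dots> = fs"
      unfolding s1(2) by (simp add: comp_def)
    finally have "eval D (Ctor k (map Var ?xs)) s1 = ObjV v"
      using v by simp
    then have "yields D I' (Assign x (Ctor (0 + k) (map Var ?xs))) s1 h Top (s1(x := ObjV v)) h"
      unfolding yields_Assign by simp
    from yields_SeqI[OF s1(1) this] have "yields D I' (havoc_ctors N x 0 C) ?s h Top (s1(x := ObjV v)) h"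
      by (rule yields_havoc_ctors) (use v in simp_all)
    with 2[of s h, OF s] have "yields D I' (havoc_obj N C x) s h Top (s1(x := ObjV v)) h"
      unfolding havoc_obj_def by (rule yields_SeqI)
    moreover have "x \<noteq> seed N" using x by auto
    ultimately show "\<exists>s1. yields D I' (havoc_obj N C x) s h Top s1 h \<and> s1 x = ObjV v \<and>
        s1 (seed N) = IntV sd'"
      using s1(3) by (intro exI[of _ "s1(x := ObjV v)"]) auto
  qed
qed

end

section \<open>Completeness: the encoding follows a given execution\<close>

text \<open>Returns the element and not its position, because the address of the failing read is
  what \<open>L\<close> will be.\<close>

fun first_failure :: "(int \<Rightarrow> 'a \<Rightarrow> bool) \<Rightarrow> int \<Rightarrow> 'a list \<Rightarrow> 'a option" where
  "first_failure Q n [] = None"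
| "first_failure Q n (x # xs) = (if Q (n + 1) x then first_failure Q (n + 1) xs else Some x)"

lemma first_failure_None: "first_failure Q n xs = None \<longleftrightarrow> numbered Q n xs"
  by (induction xs arbitrary: n) auto

lemma first_failure_append:
  "first_failure Q n (xs @ ys) = (case first_failure Q n xs of
     None \<Rightarrow> first_failure Q (n + int (length xs)) ys | Some x \<Rightarrow> Some x)"
  by (induction xs arbitrary: n) (auto simp: add.assoc split: option.split)

context encoding
begin

text \<open>An interpretation of the encoding may contain tuples with negative addresses, which one
  of the program may not. So \<open>I\<close> and \<open>I'\<close> need to agree only on the tuples
  that this run tests. Typing of the objects read makes them reachable by havoc.\<close>

definition admissible :: "event list \<Rightarrow> bool" where
  "admissible tr \<longleftrightarrow>
     (\<forall>P vs. EvPred P vs \<in> set tr \<longrightarrow> P \<noteq> R \<longrightarrow> (vs \<in> I P \<longleftrightarrow> vs \<in> I' P)) \<and>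
     (\<forall>(a, v) \<in> set (reads tr). has_type C (ObjV v) TObj)"

lemma admissible_append: "admissible (tr1 @ tr2) \<longleftrightarrow> admissible tr1 \<and> admissible tr2"
  unfolding admissible_def by auto

lemma admissible_Cons: "admissible (ev # tr) \<longleftrightarrow> admissible [ev] \<and> admissible tr"
  using admissible_append[of "[ev]" tr] by simp

text \<open>The havocs consume the seed from its low end, so that the initial seed \<open>sd\<close> depends on the
  seed \<open>sd'\<close> to be left over; it must not depend on the stack of the encoded program.\<close>

definition follows ::
  "stmt \<Rightarrow> stack \<Rightarrow> heap \<Rightarrow> int \<Rightarrow> int \<Rightarrow> outcome \<Rightarrow> stack \<Rightarrow> heap \<Rightarrow> int \<Rightarrow> int \<Rightarrow> bool" where
  "follows S s h n sd b s1 h1 n1 sd' \<longleftrightarrow>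
     (\<forall>s' h'. sim s' s h n \<longrightarrow> s' (seed N) = IntV sd \<longrightarrow>
       (\<exists>s1'. yields D I' (enc S) s' h' b s1' h' \<and> sim s1' s1 h1 n1 \<and> s1' (seed N) = IntV sd'))"

definition refutes :: "stmt \<Rightarrow> stack \<Rightarrow> heap \<Rightarrow> int \<Rightarrow> int \<Rightarrow> bool" where
  "refutes S s h n sd \<longleftrightarrow>
     (\<forall>s' h'. sim s' s h n \<longrightarrow> s' (seed N) = IntV sd \<longrightarrow>
       (\<exists>P vs s1' h1'. yields D I' (enc S) s' h' (Bot P vs) s1' h1'))"

lemma follows_acts:
  assumes "\<And>s'. sim s' s h n \<Longrightarrow> \<exists>s1'. acts (enc S) s' s1' \<and> sim s1' s1 h1 n1 \<and> s1' (seed N) = s' (seed N)"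
  shows "follows S s h n sd Top s1 h1 n1 sd"
  unfolding follows_def using assms acts_yields by metis

lemma follows_SeqI:
  assumes "follows S1 s h n sd Top s1 h1 n1 sd1" and "follows S2 s1 h1 n1 sd1 b s2 h2 n2 sd2"
  shows "follows (S1 ;; S2) s h n sd b s2 h2 n2 sd2"
  unfolding follows_def
proof (intro allI impI)
  fix s' h'
  assume "sim s' s h n" "s' (seed N) = IntV sd"
  with assms(1) obtain s1' where 1: "yields D I' (enc S1) s' h' Top s1' h'" "sim s1' s1 h1 n1"
    "s1' (seed N) = IntV sd1" unfolding follows_def by blast
  with assms(2) obtain s2' where 2: "yields D I' (enc S2) s1' h' b s2' h'" "sim s2' s2 h2 n2"
    "s2' (seed N) = IntV sd2" unfolding follows_def by blast
  from yields_SeqI[OF 1(1) 2(1)] 2(2,3)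
  show "\<exists>s1'. yields D I' (enc (S1 ;; S2)) s' h' b s1' h' \<and> sim s1' s2 h2 n2 \<and> s1' (seed N) = IntV sd2"
    unfolding enc_stmt.simps by blast
qed

lemma follows_Seq_abort:
  "follows S1 s h n sd b s1 h1 n1 sd1 \<Longrightarrow> b \<noteq> Top \<Longrightarrow> follows (S1 ;; S2) s h n sd b s1 h1 n1 sd1"
  unfolding follows_def enc_stmt.simps yields_Seq by blast

lemma follows_IfI:
  assumes "follows (if eval D e s = IntV 0 then S2 else S1) s h n sd b s1 h1 n1 sd1" and "vars_exp e \<subseteq> X"
  shows "follows (If e S1 S2) s h n sd b s1 h1 n1 sd1"
  using assms(1) sim_eval[OF _ assms(2)]
  unfolding follows_def enc_stmt.simps yields_If by (cases "eval D e s = IntV 0") simp_all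

lemma follows_WhileI:
  "follows (If e (S ;; While e S) Skip) s h n sd b s1 h1 n1 sd1 \<Longrightarrow> follows (While e S) s h n sd b s1 h1 n1 sd1"
  unfolding follows_def enc_stmt.simps yields_While[of D I' e] .

lemma refutes_Seq1: "refutes S1 s h n sd \<Longrightarrow> refutes (S1 ;; S2) s h n sd"
  unfolding refutes_def enc_stmt.simps yields_Seq by blast

lemma refutes_Seq2:
  assumes "follows S1 s h n sd Top s1 h1 n1 sd1" and "refutes S2 s1 h1 n1 sd1"
  shows "refutes (S1 ;; S2) s h n sd"
  using assms unfolding follows_def refutes_def enc_stmt.simps yields_Seq by meson

lemma refutes_IfI:
  assumes "refutes (if eval D e s = IntV 0 then S2 else S1) s h n sd" and "vars_exp e \<subseteq> X"
  shows "refutes (If e S1 S2) s h n sd"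
  using assms(1) sim_eval[OF _ assms(2)]
  unfolding refutes_def enc_stmt.simps yields_If by (cases "eval D e s = IntV 0") simp_all

lemma refutes_WhileI: "refutes (If e (S ;; While e S) Skip) s h n sd \<Longrightarrow> refutes (While e S) s h n sd"
  unfolding refutes_def enc_stmt.simps yields_While[of D I' e] .

lemma follows_Read:
  assumes ok: "encodable (Read x q)" and a: "a = int_of (s q)" and v: "v = heap_read D h a"
    and rec: "recorded (n + 1) v" and o: "has_type C (ObjV v) TObj"
  shows "\<exists>sd. follows (Read x q) s h n sd Top (s(x := ObjV v)) h (n + 1) sd'"
proof (cases "L = a")
  case True
  \<comment> \<open>No guess is made at address \<open>L\<close>, so the seed is passed on
    unchanged.\<close>
  have "follows (Read x q) s h n sd' Top (s(x := ObjV v)) h (n + 1) sd'"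
  proof (rule follows_acts)
    fix s'
    assume "sim s' s h n"
    from enc_Read_last[OF this ok a v True] rec
    show "\<exists>s1'. acts (enc (Read x q)) s' s1' \<and> sim s1' (s(x := ObjV v)) h (n + 1) \<and>
        s1' (seed N) = s' (seed N)" by metis
  qed
  then show ?thesis by blast
next
  case False
  have x: "x \<in> X" using ok by (simp add: encodable_def)
  obtain sd where sd: "\<And>s h. s (seed N) = IntV sd \<Longrightarrow>
    \<exists>s1. yields D I' (havoc_obj N C x) s h Top s1 h \<and> s1 x = ObjV v \<and> s1 (seed N) = IntV sd'"
    using yields_havoc_obj[OF x o] by metis
  have "follows (Read x q) s h n sd Top (s(x := ObjV v)) h (n + 1) sd'"
    unfolding follows_def
  proof (intro allI impI)
    fix s' h'
    assume s': "sim s' s h n" "s' (seed N) = IntV sd"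
    then have "(s'(cnt N := IntV (n + 1))) (seed N) = IntV sd" by simp
    from sd[of "s'(cnt N := IntV (n + 1))" h', OF this] obtain s1' where
      1: "yields D I' (havoc_obj N C x) (s'(cnt N := IntV (n + 1))) h' Top s1' h'" "s1' x = ObjV v"
      "s1' (seed N) = IntV sd'" by blast
    have "yields D I' (enc (Read x q)) s' h' Top s1' h'"
      unfolding enc_Read_other(1)[OF s'(1) ok a v False] using 1 rec by blast
    with 1(3) enc_Read_other(2)[OF s'(1) ok a v False 1(1,2)]
    show "\<exists>s1'. yields D I' (enc (Read x q)) s' h' Top s1' h' \<and> sim s1' (s(x := ObjV v)) h (n + 1) \<and>
        s1' (seed N) = IntV sd'" by blast
  qed
  then show ?thesis by blast
qed

text \<open>As every read is recorded, assertions of \<open>R\<close> at \<open>L\<close> succeed,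
  and elsewhere the right guess passes the assume. The induction has to be general in
  \<open>sd'\<close>, for the seed is determined backwards.\<close>

lemma enc_complete:
  assumes "exec D I S s h tr r" and "r = Fin b s1 h1" and "encodable S" and "admissible tr"
    and "numbered (\<lambda>k (a, v). recorded k v) n (reads tr)"
  shows "\<exists>sd. follows S s h n sd b s1 h1 (n + int (length (reads tr))) sd'"
  using assms
proof (induction arbitrary: b s1 h1 n sd' rule: exec.induct)
  case (cut S s h)
  then show ?case by simp
next
  case (assign v e s x h)
  have "vars_exp e \<subseteq> X" using assign.prems(2) by (simp add: encodable_def)
  have "follows (Assign x e) s h n sd' Top (s(x := eval D e s)) h n sd'"
  proof (rule follows_acts)
    fix s'
    assume s': "sim s' s h n"
    have "x \<noteq> seed N" using assign.prems(2) by (auto simp: encodable_def)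
    with enc_Assign[OF s' assign.prems(2)] sim_eval[OF s' \<open>vars_exp e \<subseteq> X\<close>]
    show "\<exists>s1'. acts (enc (Assign x e)) s' s1' \<and> sim s1' (s(x := eval D e s)) h n \<and>
        s1' (seed N) = s' (seed N)"
      by (intro exI[of _ "s'(x := eval D e s')"]) (simp add: acts_def)
  qed
  with assign show ?case by auto
next
  case (alloc v e s h h' a q)
  have "follows (Alloc q e) s h n sd' Top (s(q := IntV (int (length h) + 1))) (h @ [v]) n sd'"
    by (rule follows_acts) (metis enc_Alloc alloc.prems(2) alloc.hyps(1))
  with alloc show ?case by (auto simp: allocate_def)
next
  case (load a s q v h x)
  with follows_Read[where s = s, OF load.prems(2) load.hyps, of n sd'] show ?case
    by (auto simp: admissible_def)
next
  case (store a s q v e h)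
  have "follows (Write q e) s h n sd' Top s (heap_write h a v) n sd'"
    by (rule follows_acts) (metis enc_Write store.prems(2) store.hyps)
  with store show ?case by auto
next
  case (skip s h)
  have "follows Skip s h n sd' Top s h n sd'"
    by (rule follows_acts) (auto simp: acts_def)
  with skip show ?case by auto
next
  case (seq S1 s h tr1 s2 h2 S2 tr2 r)
  let ?n = "n + int (length (reads tr1))"
  have ok: "encodable S1" "encodable S2" "admissible tr1" "admissible tr2"
    "numbered (\<lambda>k (a, v). recorded k v) n (reads tr1)"
    "numbered (\<lambda>k (a, v). recorded k v) ?n (reads tr2)"
    using seq.prems by (simp_all add: encodable_Seq admissible_append)
  \<comment> \<open>The second statement is treated first: its initial seed is what the first one
    has to leave over.\<close>
  obtain sd2 where 2: "follows S2 s2 h2 ?n sd2 b s1 h1 (?n + int (length (reads tr2))) sd'"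
    using seq.IH(2)[OF seq.prems(1) ok(2,4,6)] by blast
  obtain sd1 where "follows S1 s h n sd1 Top s2 h2 ?n sd2"
    using seq.IH(1)[OF refl ok(1,3,5)] by blast
  from follows_SeqI[OF this 2] show ?case by (auto simp: ac_simps)
next
  case (seq_abort S1 s h tr r S2)
  have ok: "encodable S1" "b \<noteq> Top" using seq_abort.prems seq_abort.hyps(2) by (auto simp: encodable_Seq)
  with seq_abort.IH[OF seq_abort.prems(1) ok(1) seq_abort.prems(3,4)] follows_Seq_abort
  show ?case by blast
next
  case (if_true v e s S1 h tr r S2)
  have ok: "encodable S1" "vars_exp e \<subseteq> X" using encodable_IfD[OF if_true.prems(2)] by auto
  have "\<exists>sd. follows S1 s h n sd b s1 h1 (n + int (length (reads tr))) sd'"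
    using if_true.prems admissible_Cons[of _ tr] by (intro if_true.IH ok) auto
  then obtain sd where "follows (if eval D e s = IntV 0 then S2 else S1) s h n sd b s1 h1
      (n + int (length (reads tr))) sd'"
    using if_true.hyps by auto
  from follows_IfI[OF this ok(2)] show ?case by auto
next
  case (if_false v e s S2 h tr r S1)
  have ok: "encodable S2" "vars_exp e \<subseteq> X" using encodable_IfD[OF if_false.prems(2)] by auto
  have "\<exists>sd. follows S2 s h n sd b s1 h1 (n + int (length (reads tr))) sd'"
    using if_false.prems admissible_Cons[of _ tr] by (intro if_false.IH ok) auto
  then obtain sd where "follows (if eval D e s = IntV 0 then S2 else S1) s h n sd b s1 h1
      (n + int (length (reads tr))) sd'"
    using if_false.hyps by auto
  from follows_IfI[OF this ok(2)] show ?case by auto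
next
  case (while e S s h tr r)
  have "encodable (If e (S ;; While e S) Skip)" using encodable_WhileD[OF while.prems(2)] by blast
  from while.IH[OF while.prems(1) this while.prems(3,4)] follows_WhileI show ?case by blast
next
  case (assume_ok v e s h)
  have "vars_exp e \<subseteq> X" using assume_ok.prems(2) by (simp add: encodable_def)
  have "follows (Assume e) s h n sd' Top s h n sd'"
    using sim_eval[OF _ \<open>vars_exp e \<subseteq> X\<close>] assume_ok.hyps by (intro follows_acts) (auto simp: acts_def)
  with assume_ok show ?case by auto
next
  case (assert_ok v e s h)
  have "vars_exp e \<subseteq> X" using assert_ok.prems(2) by (simp add: encodable_def)
  have "follows (Assert e) s h n sd' Top s h n sd'"
    using sim_eval[OF _ \<open>vars_exp e \<subseteq> X\<close>] assert_ok.hyps by (intro follows_acts) (auto simp: acts_def)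
  with assert_ok show ?case by auto
next
  case (assert_fail v e s h)
  have "vars_exp e \<subseteq> X" using assert_fail.prems(2) by (simp add: encodable_def)
  have "follows (Assert e) s h n sd' (Bot FSym []) s h n sd'"
    using sim_eval[OF _ \<open>vars_exp e \<subseteq> X\<close>] assert_fail.hyps by (simp add: follows_def)
  with assert_fail show ?case by auto
next
  case (assumeP_ok vs s es P h)
  have es: "(\<Union>e \<in> set es. vars_exp e) \<subseteq> X" "P \<noteq> R" using assumeP_ok.prems(2) by (auto simp: encodable_def)
  have I': "vs \<in> I' P" using es assumeP_ok.prems(3) assumeP_ok.hyps by (auto simp: admissible_def)
  have "follows (AssumeP P es) s h n sd' Top s h n sd'"
    using sim_eval_list[OF _ es(1), of _ s h n] I' unfolding assumeP_ok.hyps(1) follows_def by (auto cong: map_cong)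
  with assumeP_ok show ?case by auto
next
  case (assertP_ok vs s es P h)
  have es: "(\<Union>e \<in> set es. vars_exp e) \<subseteq> X" "P \<noteq> R" using assertP_ok.prems(2) by (auto simp: encodable_def)
  have I': "vs \<in> I' P" using es assertP_ok.prems(3) assertP_ok.hyps by (auto simp: admissible_def)
  have "follows (AssertP P es) s h n sd' Top s h n sd'"
    using sim_eval_list[OF _ es(1), of _ s h n] I' unfolding assertP_ok.hyps(1) follows_def by (auto cong: map_cong)
  with assertP_ok show ?case by auto
next
  case (assertP_fail vs s es P h)
  have es: "(\<Union>e \<in> set es. vars_exp e) \<subseteq> X" "P \<noteq> R" using assertP_fail.prems(2) by (auto simp: encodable_def)
  have I': "vs \<notin> I' P" using es assertP_fail.prems(3) assertP_fail.hyps by (auto simp: admissible_def)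
  have "follows (AssertP P es) s h n sd' (Bot (Pred P) vs) s h n sd'"
    using sim_eval_list[OF _ es(1), of _ s h n] I' unfolding assertP_fail.hyps(1) follows_def by (auto cong: map_cong)
  with assertP_fail show ?case by auto
qed auto

text \<open>All reads before the failing one are recorded, so \<open>enc_complete\<close> leads
  there; as it is a read at \<open>L\<close>, the encoding asserts \<open>R\<close> instead of
  guessing. How the program itself goes on is irrelevant, hence \<open>r\<close> is
  arbitrary.\<close>

lemma enc_refuted:
  assumes "exec D I S s h tr r" and "encodable S" and "admissible tr"
    and "first_failure (\<lambda>k (a, v). recorded k v) n (reads tr) = Some (L, v)"
  shows "\<exists>sd. refutes S s h n sd"
  using assms
proof (induction arbitrary: n rule: exec.induct)
  case (load a s q w h x)
  then have L: "L = a" "\<not> recorded (n + 1) w" by (auto split: if_splits)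
  \<comment> \<open>Any seed would do, since the assertion fails without a havoc.\<close>
  have "refutes (Read x q) s h n 0"
    unfolding refutes_def using enc_Read_last[where s = s, OF _ load.prems(1) load.hyps L(1)] L(2) by metis
  then show ?case by blast
next
  case (seq S1 s h tr1 s2 h2 S2 tr2 r)
  let ?n = "n + int (length (reads tr1))"
  have ok: "encodable S1" "encodable S2" "admissible tr1" "admissible tr2"
    using seq.prems by (simp_all add: encodable_Seq admissible_append)
  show ?case
  proof (cases "first_failure (\<lambda>k (a, v). recorded k v) n (reads tr1)")
    case None
    with seq.prems(3) have "first_failure (\<lambda>k (a, v). recorded k v) ?n (reads tr2) = Some (L, v)"
      by (simp add: first_failure_append)
    with seq.IH(2) ok obtain sd2 where 2: "refutes S2 s2 h2 ?n sd2" by blast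
    from None have "numbered (\<lambda>k (a, v). recorded k v) n (reads tr1)"
      by (simp add: first_failure_None)
    from enc_complete[OF seq.hyps(1) refl ok(1,3) this] refutes_Seq2[OF _ 2] show ?thesis by blast
  next
    case (Some y)
    with seq.prems(3) have "first_failure (\<lambda>k (a, v). recorded k v) n (reads tr1) = Some (L, v)"
      by (simp add: first_failure_append)
    with seq.IH(1) ok refutes_Seq1 show ?thesis by blast
  qed
next
  case (seq_abort S1 s h tr r S2)
  then show ?case using refutes_Seq1 by (simp add: encodable_Seq) blast
next
  case (if_true v e s S1 h tr r S2)
  have ok: "encodable S1" "vars_exp e \<subseteq> X" using encodable_IfD[OF if_true.prems(1)] by auto
  have "\<exists>sd. refutes S1 s h n sd"
    using if_true.prems admissible_Cons[of _ tr] by (intro if_true.IH ok) auto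
  then obtain sd where "refutes (if eval D e s = IntV 0 then S2 else S1) s h n sd"
    using if_true.hyps by auto
  from refutes_IfI[OF this ok(2)] show ?case by auto
next
  case (if_false v e s S2 h tr r S1)
  have ok: "encodable S2" "vars_exp e \<subseteq> X" using encodable_IfD[OF if_false.prems(1)] by auto
  have "\<exists>sd. refutes S2 s h n sd"
    using if_false.prems admissible_Cons[of _ tr] by (intro if_false.IH ok) auto
  then obtain sd where "refutes (if eval D e s = IntV 0 then S2 else S1) s h n sd"
    using if_false.hyps by auto
  from refutes_IfI[OF this ok(2)] show ?case by auto
next
  case (while e S s h tr r)
  have "encodable (If e (S ;; While e S) Skip)" using encodable_WhileD[OF while.prems(1)] by blast
  from while.IH[OF this while.prems(2,3)] refutes_WhileI show ?case by blast
qed auto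

end

section \<open>Equi-safety\<close>

lemma in_reads: "(a, v) \<in> set (reads tr) \<Longrightarrow> \<exists>x. EvRead x a v \<in> set tr"
  by (auto simp: reads_def split: event.splits)

lemma reads_prefix: "prefix tr tr' \<Longrightarrow> k < length (reads tr) \<Longrightarrow> reads tr ! k = reads tr' ! k"
  by (auto simp: prefix_def nth_append)

lemma heap_read_empty [simp]: "heap_read D [] a = D"
  by (auto simp: heap_read_def)

definition start :: "aux_vars \<Rightarrow> obj \<Rightarrow> stack \<Rightarrow> stack" where
  "start N D s = s(cnt_alloc N := IntV 0, cnt N := IntV 0, last_obj N := ObjV D)"

lemma yields_Enc:
  "yields D I (body (Enc R inp N p)) s h b s1 h1 \<longleftrightarrow>
     yields D I (enc_stmt R inp N (ctors p) (body p)) (start N D s) h b s1 h1"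
  by (auto simp: Enc_def start_def)

lemma safe_Enc_if_safe:
  assumes wf: "wf_program p" and inp: "input_var inp p" and det: "determined_by inp p"
    and ok: "alloc_ok (body p)" "R \<notin> preds_stmt (body p)"
    and fresh: "fresh_vars N (insert inp (vars_stmt (body p)))"
    and safe: "safe p"
  shows "safe (Enc R inp N p)"
proof -
  let ?C = "ctors p" and ?G = "vars p" and ?D = "def_obj p" and ?p' = "Enc R inp N p"
  let ?X = "insert inp (vars_stmt (body p))"
  from safe obtain I where I: "I \<in> interps p" and
    safe: "\<And>s P vs s1 h1. s \<in> stacks p \<Longrightarrow> \<not> yields ?D I (body p) s [] (Bot P vs) s1 h1"
    unfolding safe_iff by blast
  have wf: "nonrecursive ?C" "has_type ?C (ObjV ?D) TObj" "wt_stmt ?C (preds p) ?G (body p)"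
    using wf by (simp_all add: wf_program_def)
  have inp: "?G inp = TInt" "inp \<notin> assigned (body p)" using inp by (simp_all add: input_var_def)
  have typed: "\<forall>ev \<in> set tr. typed_event ?C (preds p) ev"
    if "s \<in> stacks p" "exec ?D I (body p) s [] tr r" for s tr r
    using exec_typed[OF that(2) wf(3) _ _ wf(2,1)] that(1)
    by (simp add: typed_stack_def stacks_def typed_heap_def)
  \<comment> \<open>Initial segments are used so that reads of blocking or diverging runs are
    recorded too. Position \<open>k\<close> of the list is read number \<open>k + 1\<close>.\<close>
  define K where "K = {[IntV i, IntV (int k + 1), ObjV v] | i k v.
    \<exists>s \<in> stacks p. \<exists>tr \<in> executions ?D I (body p) s []. s inp = IntV i \<and> k < length (reads tr) \<and>
      snd (reads tr ! k) = v}"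
  define I' where "I' = I(R := K)"
  have I'_R: "I' R = K" by (simp add: I'_def)
  have "I' \<in> interps ?p'"
  proof -
    have "list_all2 (has_type (ctors ?p')) vs (preds ?p' P)" if vs: "vs \<in> I' P" for P vs
    proof (cases "P = R")
      case True
      with vs obtain i k v s tr r where vs': "vs = [IntV i, IntV (int k + 1), ObjV v]"
        and *: "s \<in> stacks p" "exec ?D I (body p) s [] tr r" "k < length (reads tr)" "snd (reads tr ! k) = v"
        by (auto simp: I'_def K_def executions_def)
      have "(fst (reads tr ! k), v) \<in> set (reads tr)" using *(3,4) by (metis nth_mem prod.collapse)
      with typed[OF *(1,2)] have "has_type ?C (ObjV v) TObj" by (auto dest!: in_reads)
      from has_type_redeclare[OF this] show ?thesis
        using True vs' by (simp add: Enc_def redeclare_adt_def)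
    next
      case False
      then have "list_all2 (has_type ?C) vs (preds p P)"
        using vs I by (auto simp: I'_def interps_def)
      then show ?thesis
        using False has_type_redeclare[of ?C]
        by (auto simp: Enc_def redeclare_adt_def list_all2_conv_all_nth)
    qed
    then show ?thesis by (simp add: interps_def)
  qed
  moreover have "\<not> yields ?D I' (body ?p') s' [] (Bot P vs) s1' h1'" if s': "s' \<in> stacks ?p'" for s' P vs s1' h1'
  proof
    assume bot: "yields ?D I' (body ?p') s' [] (Bot P vs) s1' h1'"
    have s'_typed: "has_type (redeclare_adt ?C) (s' x) (redeclare (?G x))"
      if "x \<notin> set (scalar_vars N) \<union> range (fld N)" for x
      using s' that by (auto simp: stacks_def Enc_def redeclare_adt_def scalar_vars_def dest: spec[of _ x])
    have not_fresh: "x \<notin> set (scalar_vars N) \<union> range (fld N)" if "x \<in> ?X" for x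
      using fresh that unfolding fresh_vars_def by blast
    have "has_type (redeclare_adt ?C) (s' inp) (redeclare (?G inp))"
      by (rule s'_typed, rule not_fresh) simp
    then obtain i where i: "s' inp = IntV i" using inp(1) by auto
    have "last_addr N \<noteq> last_obj N" using fresh by (auto simp: fresh_vars_def scalar_vars_def)
    then have "has_type (redeclare_adt ?C) (s' (last_addr N)) TInt"
      using s' by (auto simp: stacks_def Enc_def redeclare_adt_def scalar_vars_def dest: spec[of _ "last_addr N"])
    then obtain L where L: "s' (last_addr N) = IntV L" by auto
    \<comment> \<open>The auxiliary names may be declared differently in \<open>p\<close>, so
      outside \<open>?X\<close> the values are replaced by ones of the right type. Addresses in
      \<open>?X\<close> may be negative, so \<open>s0\<close> need not be a stack of
      \<open>p\<close>.\<close>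
    define s0 where "s0 x = (if x \<in> ?X then s' x else if ?G x = TObj then ObjV ?D else IntV 0)" for x
    have s0: "has_type (redeclare_adt ?C) (s0 x) (redeclare (?G x))" for x
      using s'_typed[OF not_fresh, of x] has_type_redeclare[OF wf(2)]
      by (cases "?G x") (auto simp: s0_def)
    interpret encoding ?C "preds p" ?G ?D R inp N ?X I I' i L
      by unfold_locales (use wf(1) fresh in \<open>auto simp: I'_def K_def\<close>)
    have enc_ok: "encodable (body p)"
      using wf(3) ok inp(2) by (auto simp: encodable_def)
    have "of_kind (?G x) (s0 x)" for x
      using has_type_of_kind[OF s0[of x]] by (cases "s0 x") auto
    moreover have "start N ?D s' x = s0 x" if "x \<in> ?X" for x
      using in_X_not_fresh[OF that] that by (simp add: start_def s0_def)
    moreover have "s0 inp = IntV i" using i by (simp add: s0_def)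
    ultimately have sim: "sim (start N ?D s') s0 [] 0"
      using L by (simp add: sim_def start_def)
    have "determinate 0 (body p) s0 []"
      unfolding determinate_def numbered_iff_nth
    proof (intro allI impI)
      fix tr r k
      assume tr: "exec ?D I (body p) s0 [] tr r" and k: "k < length (reads tr)"
      \<comment> \<open>\<open>K\<close> speaks of stacks of \<open>p\<close> only, so the trace is
        first moved to such a stack.\<close>
      obtain s f where s: "s \<in> stacks p" "s inp = s0 inp"
        and ex: "exec ?D I (body p) s [] tr (ren_result ?C ?G f r)"
        using exec_natural_stack[OF assms(1) inp(1) det I s0 tr] by blast
      have s_inp: "s inp = IntV i" using s(2) i by (simp add: s0_def)
      obtain a v where v: "reads tr ! k = (a, v)" by (cases "reads tr ! k")
      have "w = v" if "recorded (int k + 1) w" for w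
      proof -
        from that have "[IntV i, IntV (int k + 1), ObjV w] \<in> K" by (simp add: recorded_def I'_R)
        then obtain s2 tr2 r2 where 2: "s2 \<in> stacks p" "s2 inp = IntV i"
          "exec ?D I (body p) s2 [] tr2 r2" "k < length (reads tr2)" "snd (reads tr2 ! k) = w"
          by (auto simp: K_def executions_def)
        \<comment> \<open>By determinacy the recorded trace is also one from \<open>s\<close>. There
          the two traces are comparable and hence agree at position \<open>k\<close>.\<close>
        have "executions ?D I (body p) s2 [] = executions ?D I (body p) s []"
          using det I s(1) 2(1,2) s_inp unfolding determined_by_def emptyHeap_def by metis
        with 2(3) obtain r3 where "exec ?D I (body p) s [] tr2 r3"
          by (auto simp: executions_def)
        from exec_chain[OF ex this] have "reads tr ! k = reads tr2 ! k"
          using reads_prefix[of tr tr2 k] reads_prefix[of tr2 tr k] k 2(4) by auto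
        with v 2(5) show ?thesis by simp
      qed
      moreover have "recorded (int k + 1) v"
      proof -
        have "tr \<in> executions ?D I (body p) s []" "snd (reads tr ! k) = v"
          using ex v by (auto simp: executions_def)
        with s(1) s_inp k show ?thesis unfolding recorded_def I'_R K_def by blast
      qed
      ultimately have "\<forall>w. recorded (int k + 1) w \<longleftrightarrow> w = v" by blast
      then show "case reads tr ! k of (a, v) \<Rightarrow> \<forall>w. recorded (0 + 1 + int k) w \<longleftrightarrow> w = v"
        unfolding v by (simp add: add.commute)
    qed
    from enc_sound[OF _ enc_ok bot[unfolded yields_Enc] sim this] obtain tr s1 h1 where
      "exec ?D I (body p) s0 [] tr (Fin (Bot P vs) s1 h1)" by (auto simp: I'_def)
    \<comment> \<open>Renaming the result leaves the outcome alone, so \<open>p\<close> fails from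
      one of its own stacks.\<close>
    from exec_natural_stack[OF assms(1) inp(1) det I s0 this] obtain s f where
      "s \<in> stacks p" "exec ?D I (body p) s [] tr (ren_result ?C ?G f (Fin (Bot P vs) s1 h1))" by blast
    with safe show False by (auto simp: yields_def)
  qed
  moreover have "def_obj ?p' = ?D" by (simp add: Enc_def)
  ultimately show ?thesis unfolding safe_iff by (intro bexI[of _ I']) simp_all
qed

lemma safe_if_safe_Enc:
  assumes wf: "wf_program p" and inp: "input_var inp p"
    and ok: "alloc_ok (body p)" "R \<notin> preds_stmt (body p)"
    and fresh: "fresh_vars N (insert inp (vars_stmt (body p)))"
    and safe: "safe (Enc R inp N p)"
  shows "safe p"
proof -
  let ?C = "ctors p" and ?G = "vars p" and ?D = "def_obj p" and ?p' = "Enc R inp N p"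
  let ?X = "insert inp (vars_stmt (body p))"
  have D': "def_obj ?p' = ?D" by (simp add: Enc_def)
  from safe obtain I' where I': "I' \<in> interps ?p'" and
    safe: "\<And>s P vs s1 h1. s \<in> stacks ?p' \<Longrightarrow> \<not> yields ?D I' (body ?p') s [] (Bot P vs) s1 h1"
    unfolding safe_iff D' by blast
  have wf: "nonrecursive ?C" "has_type ?C (ObjV ?D) TObj" "wt_stmt ?C (preds p) ?G (body p)"
    using wf by (simp_all add: wf_program_def)
  have inp: "?G inp = TInt" "inp \<notin> assigned (body p)" using inp by (simp_all add: input_var_def)
  have R_typed: "\<exists>x. w = ObjV x" if "[u, v, w] \<in> I' R" for u v w
  proof -
    from that I' have "list_all2 (has_type (ctors ?p')) [u, v, w] (preds ?p' R)"
      unfolding interps_def by blast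
    then have "has_type (ctors ?p') w TObj" by (simp add: Enc_def)
    then show ?thesis using has_type_obj_of by metis
  qed
  define I where "I P = {vs \<in> I' P. list_all2 (has_type ?C) vs (preds p P)}" for P
  have "I \<in> interps p" by (auto simp: interps_def I_def)
  moreover have "\<not> yields ?D I (body p) s [] (Bot P vs) s1 h1" if s: "s \<in> stacks p" for s P vs s1 h1
  proof
    assume "yields ?D I (body p) s [] (Bot P vs) s1 h1"
    then obtain tr where ex: "exec ?D I (body p) s [] tr (Fin (Bot P vs) s1 h1)"
      by (auto simp: yields_def)
    have s_typed: "has_type ?C (s x) (?G x)" for x using s by (simp add: stacks_def)
    from s_typed[of inp] inp(1) obtain i where i: "s inp = IntV i" by auto
    have typed: "\<forall>ev \<in> set tr. typed_event ?C (preds p) ev"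
      using exec_typed[OF ex wf(3) _ _ wf(2,1)] s_typed by (simp add: typed_stack_def typed_heap_def)
    \<comment> \<open>This is \<open>recorded\<close>, spelled out because \<open>L\<close> depends
      on it and has to be fixed before the locale can be interpreted.\<close>
    define Q where "Q k av \<longleftrightarrow> [IntV i, IntV k, ObjV (snd av)] \<in> I' R" for k and av :: "int \<times> obj"
    \<comment> \<open>If all reads are recorded, the failure is one of the program itself and any
      \<open>L\<close> would do.\<close>
    define L where "L = (case first_failure Q 0 (reads tr) of None \<Rightarrow> 0 | Some av \<Rightarrow> fst av)"
    interpret encoding ?C "preds p" ?G ?D R inp N ?X I I' i L
      by unfold_locales (use wf(1) fresh R_typed in auto)
    have Q: "Q = (\<lambda>k (a, v). recorded k v)"
      by (auto simp: Q_def recorded_def fun_eq_iff)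
    have enc_ok: "encodable (body p)"
      using wf(3) ok inp(2) by (auto simp: encodable_def)
    have adm: "admissible tr"
      using typed by (force simp: admissible_def I_def dest!: in_reads)
    have "\<exists>sd. \<forall>s' h'. sim s' s [] 0 \<longrightarrow> s' (seed N) = IntV sd \<longrightarrow>
        (\<exists>P vs s1' h1'. yields ?D I' (enc (body p)) s' h' (Bot P vs) s1' h1')"
    proof (cases "first_failure Q 0 (reads tr)")
      case None
      then have "numbered Q 0 (reads tr)" by (simp add: first_failure_None)
      from enc_complete[OF ex refl enc_ok adm this[unfolded Q], of 0] obtain sd m where
        "follows (body p) s [] 0 sd (Bot P vs) s1 h1 m 0" by blast
      then show ?thesis unfolding follows_def by (intro exI[of _ sd]) blast
    next
      case (Some av)
      then have "first_failure (\<lambda>k (a, v). recorded k v) 0 (reads tr) = Some (L, snd av)"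
        by (simp add: L_def Q)
      from enc_refuted[OF ex enc_ok adm this] show ?thesis unfolding refutes_def .
    qed
    then obtain sd where
      sd: "\<And>s' h'. sim s' s [] 0 \<Longrightarrow> s' (seed N) = IntV sd \<Longrightarrow>
        \<exists>P vs s1' h1'. yields ?D I' (enc (body p)) s' h' (Bot P vs) s1' h1'" by blast
    \<comment> \<open>The seed and \<open>last_addr\<close> are the values that matter here besides
      the program variables: the prelude overwrites the counters and \<open>last_obj\<close>, and
      the rest only has to respect the declarations.\<close>
    define s' where "s' x = (if x = last_obj N then ObjV ?D
      else if x \<in> set (scalar_vars N) \<union> range (fld N)
      then IntV (if x = seed N then sd else if x = last_addr N then L else 0) else s x)" for x
    have "s' \<in> stacks ?p'"
      using has_type_redeclare[OF s_typed] has_type_redeclare[OF wf(2)]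
      by (simp add: stacks_def Enc_def s'_def redeclare_adt_def)
    moreover have "sim (start N ?D s') s [] 0"
    proof -
      have "start N ?D s' x = s x" if "x \<in> ?X" for x
        using in_X_not_fresh[OF that] by (auto simp: s'_def start_def scalar_vars_def)
      moreover have "s' (last_addr N) = IntV L"
        using fresh_simps by (auto simp: s'_def scalar_vars_def)
      ultimately show ?thesis
        using i has_type_of_kind[OF s_typed] by (simp add: sim_def start_def)
    qed
    moreover have "start N ?D s' (seed N) = IntV sd"
      by (auto simp: start_def s'_def scalar_vars_def)
    ultimately show False
      using sd[of "start N ?D s'" "[]"] safe unfolding yields_Enc by blast
  qed
  ultimately show ?thesis unfolding safe_iff by blast
qed

theorem theorem4p4:
  fixes p :: program and inp :: vname and R :: pname and N :: aux_vars
  assumes "wf_program p"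
    and "input_var inp p"
    and "determined_by inp p"
    and "alloc_ok (body p)"
    and "R \<notin> preds_stmt (body p)"
    and "fresh_vars N (insert inp (vars_stmt (body p)))"
  shows "equi_safe p (Enc R inp N p)"
  unfolding equi_safe_def
  using safe_Enc_if_safe[OF assms] safe_if_safe_Enc[OF assms(1,2,4-)] by blast

end
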